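(* Let $X_\bullet$ be a $2$-Segal set. Then there is a one-to-one correspondence between paracyclic structures on $X_\bullet$ and equivalence classes of Frobenius structures on the pseudomonoid in $\mathrm{Span}$ corresponding to $X_\bullet$.
   Context: **2-Segal sets.** For a simplicial set $X_\bullet$ write $d_i^n:X_n\to X_{n-1}$ and $s_i^n:X_n\to X_{n+1}$ for face and degeneracy maps (upper indices may be dropped). Let $n\ge 2$ and let $\mathcal T$ be a triangulation of the regular $(n+1)$-gon with vertices labeled $0,\dots,n$ clockwise. Each triangle with vertices $v_0<v_1<v_2$ gives a map $[2]\to[n]$, hence a map $X_n\to X_2$; together these give $\hat{\mathcal T}:X_n\to X_2\times_{X_1}\cdots\times_{X_1}X_2$, where the fibre product consists of families of $2$-simplices indexed by the triangles of $\mathcal T$ whose faces agree along each edge shared by two triangles. $X_\bullet$ is *$2$-Segal* if $\hat{\mathcal T}$ is a bijection for every $n \geq 2$ and every triangulation $\mathcal T$. For the two triangulations of the square the maps are $\hat{\mathcal T}_{13}(\psi)=(d_3\psi,d_1\psi)\in\{(\xi,\xi'):d_1\xi=d_2\xi'\}$ and $\hat{\mathcal T}_{02}(\psi)=(d_2\psi,d_0\psi)\in\{(\xi,\xi'):d_0\xi=d_1\xi'\}$. **The bicategory $\mathrm{Span}$.** Objects are sets; a morphism $X\to Y$ is a span $X\xleftarrow{f_1}A\xrightarrow{f_2}Y$ of sets; a $2$-morphism from $X\xleftarrow{f_1}A\xrightarrow{f_2}Y$ to $X\xleftarrow{g_1}B\xrightarrow{g_2}Y$ is a map $h:A\to B$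 with $g_ih=f_i$ for $i=1,2$; composition is by pullback, identities are identity spans, and associators/unitors are the canonical ones. It is a monoidal bicategory with product the Cartesian product, unit $I=\{\bullet\}$, and canonical structure isomorphisms (which are suppressed below). For morphisms $f:X\to X'$, $g:Y\to Y'$ there is a canonical invertible $2$-morphism $c_{f,g}:(\mathrm{id}_{X'}\times g)\circ(f\times\mathrm{id}_Y)\Rightarrow(f\times\mathrm{id}_{Y'})\circ(\mathrm{id}_X\times g)$. **The pseudomonoid corresponding to a $2$-Segal set $X_\bullet$.** The object is $X_1$; the unit $\eta$ is the span $\{\bullet\}\leftarrow X_0\xrightarrow{s_0}X_1$; the multiplication $\mu$ is the span $X_1\times X_1\xleftarrow{(d_2,d_0)}X_2\xrightarrow{d_1}X_1$; the associator $a:\mu\circ(\mu\times\mathrm{id})\Rightarrow\mu\circ(\mathrm{id}\times\mu)$ is $\hat{\mathcal T}_{02}\circ\hat{\mathcal T}_{13}^{-1}$ (identifying the apexes of these composites with $\{(\xi,\xi'):d_1\xi=d_2\xi'\}$ and $\{(\xi,\xi'):d_0\xi=d_1\xi'\}$ in $X_2 \times X_2$); the left unitor $\mu\circ(\eta\times\mathrm{id})\Rightarrow\mathrm{id}$ and right unitor $\mu\circ(\mathrm{id}\times\eta)\Rightarrow\mathrm{id}$ are the inverses of the span maps $x\mapsto(d_1x,s_0x)$ and $x\mapsto(d_0x,s_1x)$. **Frobenius structures.** A *Frobenius structure* on a pseudomonoid with object $M$ and multiplication $\mu$ is a morphism $\varepsilon:M\to I$ (the counit) such that the pairing $\alpha:=\varepsilon\circ\mu:M\otimes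 M\to I$ is *biexact*, i.e. there exist a morphism $\beta:I\to M\otimes M$ and invertible $2$-morphisms $z:(\mathrm{id}_M\otimes\alpha)\circ(\beta\otimes\mathrm{id}_M)\Rightarrow\mathrm{id}_M$ and $n:(\alpha\otimes\mathrm{id}_M)\circ(\mathrm{id}_M\otimes\beta)\Rightarrow\mathrm{id}_M$ such that: (i) the $2$-morphism $\alpha\circ(\alpha\otimes\mathrm{id}\otimes\mathrm{id})\circ(\mathrm{id}\otimes\beta\otimes\mathrm{id})\Rightarrow\alpha$ given by applying $n$ to the factor $(\alpha\otimes\mathrm{id})\circ(\mathrm{id}\otimes\beta)$ on the first three strands equals the composite of $c_{\alpha,\alpha}$ (interchanging the two copies of $\alpha$, giving $\alpha\circ(\mathrm{id}\otimes\mathrm{id}\otimes\alpha)\circ(\mathrm{id}\otimes\beta\otimes\mathrm{id})$) followed by $z$ applied to the factor $(\mathrm{id}\otimes\alpha)\circ(\beta\otimes\mathrm{id})$; (ii) the $2$-morphism $(\mathrm{id}\otimes\alpha\otimes\mathrm{id})\circ(\mathrm{id}\otimes\mathrm{id}\otimes\beta)\circ\beta\Rightarrow\beta$ given by applying $n$ to the factor $(\alpha\otimes\mathrm{id})\circ(\mathrm{id}\otimes\beta)$ equals the composite of $c_{\beta,\beta}$ (interchanging the two copies of $\beta$, giving $(\mathrm{id}\otimes\alpha\otimes\mathrm{id})\circ(\beta\otimes\mathrm{id}\otimes\mathrm{id})\circ\beta$) followed by $z$ applied to the factor $(\mathrm{id}\otimes\alpha)\circ(\beta\otimes\mathrm{id})$.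 Two Frobenius structures on the same pseudomonoid are *equivalent* if their counits are $2$-isomorphic. **Paracyclic structures.** The paracyclic category $\Lambda_\infty$ has objects $[n]$, $n\ge0$; a morphism $[m]\to[n]$ is an order-preserving (weakly monotone) map $f:\mathbb Z\to\mathbb Z$ with $f(i+k(m+1))=f(i)+k(n+1)$ for all $i,k\in\mathbb Z$. The simplex category $\Delta$ is identified with the subcategory of $\Lambda_\infty$ with the same objects and with those morphisms $f:[m]\to[n]$ that map $\{0,\dots,m\}$ into $\{0,\dots,n\}$. A *paracyclic set* is a functor $\Lambda_\infty^{\mathrm{op}}\to\mathrm{Set}$. A *paracyclic structure* on a simplicial set $X_\bullet$ is a paracyclic set whose restriction to $\Delta^{\mathrm{op}}$ is $X_\bullet$. Equivalently, it is a family of bijections $\tau^n:X_n\to X_n$, $n\ge 0$, such that $d_i^n\tau^n=\tau^{n-1}d_{i+1}^n$ for $i<n$, $d_n^n\tau^n=d_0^n$, $s_i^n\tau^n=\tau^{n+1}s_{i+1}^n$ for $i<n$, and $s_n^n\tau^n=(\tau^{n+1})^2s_0^n$. *)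

theory Defs
  imports "HOL-Library.FuncSet"
begin

section \<open>Simplicial and paracyclic sets\<close>

definition paracyclic_hom :: "nat \<Rightarrow> nat \<Rightarrow> (int \<Rightarrow> int) set" where
  "paracyclic_hom m n =
     {f. mono f \<and> (\<forall>i k. f (i + k * (int m + 1)) = f i + k * (int n + 1))}"

text \<open>The simplex category as a subcategory of the paracyclic category: a monotone map
  from \<open>{0..m}\<close> to \<open>{0..n}\<close> is represented by its unique periodic extension to the integers,
  so that composition and identities are those of functions.\<close>

definition simplex_hom :: "nat \<Rightarrow> nat \<Rightarrow> (int \<Rightarrow> int) set" where
  "simplex_hom m n = {f \<in> paracyclic_hom m n. f ` {0..int m} \<subseteq> {0..int n}}"

definition periodic :: "nat \<Rightarrow> nat \<Rightarrow> (nat \<Rightarrow> nat) \<Rightarrow> int \<Rightarrow> int" where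
  "periodic m n v =
     (\<lambda>i. int (v (nat (i mod (int m + 1)))) + (i div (int m + 1)) * (int n + 1))"

text \<open>Set-valued contravariant functors; \<open>act F m n f\<close> is the map \<open>F\<^sub>n \<rightarrow> F\<^sub>m\<close> induced by
  a morphism \<open>f : [m] \<rightarrow> [n]\<close>.\<close>

record 'a presheaf_data =
  ob :: "nat \<Rightarrow> 'a set"
  act :: "nat \<Rightarrow> nat \<Rightarrow> (int \<Rightarrow> int) \<Rightarrow> 'a \<Rightarrow> 'a"

definition presheaf :: "(nat \<Rightarrow> nat \<Rightarrow> (int \<Rightarrow> int) set) \<Rightarrow> 'a presheaf_data \<Rightarrow> bool" where
  "presheaf hom F \<longleftrightarrow>
     (\<forall>m n. \<forall>f\<in>hom m n. act F m n f \<in> ob F n \<rightarrow> ob F m) \<and>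
     (\<forall>n. \<forall>x\<in>ob F n. act F n n id x = x) \<and>
     (\<forall>m n p. \<forall>f\<in>hom m n. \<forall>g\<in>hom n p. \<forall>x\<in>ob F p.
        act F m p (g \<circ> f) x = act F m n f (act F n p g x))"

definition simplicial_set :: "'a presheaf_data \<Rightarrow> bool" where
  "simplicial_set X \<longleftrightarrow> presheaf simplex_hom X"

definition paracyclic_set :: "'a presheaf_data \<Rightarrow> bool" where
  "paracyclic_set P \<longleftrightarrow> presheaf paracyclic_hom P"

text \<open>The last conjunct fixes the junk values of \<open>act P\<close>, so that two paracyclic structures are
  equal as terms iff they are equal as functors.\<close>

definition paracyclic_structure :: "'a presheaf_data \<Rightarrow> 'a presheaf_data \<Rightarrow> bool" where
  "paracyclic_structure X P \<longleftrightarrow>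
     paracyclic_set P \<and> ob P = ob X \<and>
     (\<forall>m n. \<forall>f\<in>simplex_hom m n. \<forall>x\<in>ob X n. act P m n f x = act X m n f x) \<and>
     (\<forall>m n f x. f \<notin> paracyclic_hom m n \<or> x \<notin> ob P n \<longrightarrow> act P m n f x = undefined)"

definition face :: "'a presheaf_data \<Rightarrow> nat \<Rightarrow> nat \<Rightarrow> 'a \<Rightarrow> 'a" where
  "face X n i = act X (n - 1) n (periodic (n - 1) n (\<lambda>j. if j < i then j else j + 1))"

definition degen :: "'a presheaf_data \<Rightarrow> nat \<Rightarrow> nat \<Rightarrow> 'a \<Rightarrow> 'a" where
  "degen X n i = act X (n + 1) n (periodic (n + 1) n (\<lambda>j. if j \<le> i then j else j - 1))"


section \<open>2-Segal sets\<close>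

text \<open>Triangulations of the polygon with vertices \<open>0, \<dots>, n\<close>, given by their edges: a maximal set
  of pairwise non-crossing chords. Since a side crosses no chord, all sides are included. As the
  polygon has no interior vertices, its triangles are the triples of pairwise joined vertices.\<close>

definition chords :: "nat \<Rightarrow> (nat \<times> nat) set" where
  "chords n = {(a, b). a < b \<and> b \<le> n}"

definition crossing :: "nat \<times> nat \<Rightarrow> nat \<times> nat \<Rightarrow> bool" where
  "crossing = (\<lambda>(a, b) (c, d). a < c \<and> c < b \<and> b < d \<or> c < a \<and> a < d \<and> d < b)"

definition triangulation :: "nat \<Rightarrow> (nat \<times> nat) set \<Rightarrow> bool" where
  "triangulation n E \<longleftrightarrow>
     E \<subseteq> chords n \<and>
     (\<forall>e\<in>E. \<forall>e'\<in>E. \<not> crossing e e') \<and>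
     (\<forall>e\<in>chords n. (\<forall>e'\<in>E. \<not> crossing e e') \<longrightarrow> e \<in> E)"

definition triangles :: "(nat \<times> nat) set \<Rightarrow> (nat \<times> nat \<times> nat) set" where
  "triangles E = {(u, v, w). u < v \<and> v < w \<and> (u, v) \<in> E \<and> (v, w) \<in> E \<and> (u, w) \<in> E}"

definition triangle_edge :: "nat \<times> nat \<times> nat \<Rightarrow> nat \<Rightarrow> nat \<times> nat" where
  "triangle_edge = (\<lambda>(u, v, w) i. [(v, w), (u, w), (u, v)] ! i)"

definition triangle_map ::
  "'a presheaf_data \<Rightarrow> nat \<Rightarrow> nat \<times> nat \<times> nat \<Rightarrow> 'a \<Rightarrow> 'a" where
  "triangle_map X n = (\<lambda>(u, v, w). act X 2 n (periodic 2 n (\<lambda>j. [u, v, w] ! j)))"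

definition triangulation_families ::
  "'a presheaf_data \<Rightarrow> (nat \<times> nat) set \<Rightarrow> (nat \<times> nat \<times> nat \<Rightarrow> 'a) set" where
  "triangulation_families X E =
     {\<xi> \<in> triangles E \<rightarrow>\<^sub>E ob X 2.
        \<forall>t\<in>triangles E. \<forall>t'\<in>triangles E. \<forall>i<3. \<forall>j<3.
          triangle_edge t i = triangle_edge t' j \<longrightarrow> face X 2 i (\<xi> t) = face X 2 j (\<xi> t')}"

definition two_segal :: "'a presheaf_data \<Rightarrow> bool" where
  "two_segal X \<longleftrightarrow>
     simplicial_set X \<and>
     (\<forall>n\<ge>2. \<forall>E. triangulation n E \<longrightarrow>
        bij_betw (\<lambda>\<psi>. \<lambda>t\<in>triangles E. triangle_map X n t \<psi>)
          (ob X n) (triangulation_families X E))"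


section \<open>Spans\<close>

record ('x, 'y, 'a) span =
  apex :: "'a set"
  lleg :: "'a \<Rightarrow> 'x"
  rleg :: "'a \<Rightarrow> 'y"

definition is_span :: "'x set \<Rightarrow> 'y set \<Rightarrow> ('x, 'y, 'a) span \<Rightarrow> bool" where
  "is_span X Y f \<longleftrightarrow> lleg f \<in> apex f \<rightarrow> X \<and> rleg f \<in> apex f \<rightarrow> Y"

definition span_2mor ::
  "('x, 'y, 'a) span \<Rightarrow> ('x, 'y, 'b) span \<Rightarrow> ('a \<Rightarrow> 'b) \<Rightarrow> bool" where
  "span_2mor f g h \<longleftrightarrow>
     h \<in> apex f \<rightarrow> apex g \<and>
     (\<forall>a\<in>apex f. lleg g (h a) = lleg f a \<and> rleg g (h a) = rleg f a)"

definition invertible_2mor ::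
  "('x, 'y, 'a) span \<Rightarrow> ('x, 'y, 'b) span \<Rightarrow> ('a \<Rightarrow> 'b) \<Rightarrow> bool" where
  "invertible_2mor f g h \<longleftrightarrow>
     span_2mor f g h \<and>
     (\<exists>k. span_2mor g f k \<and> (\<forall>a\<in>apex f. k (h a) = a) \<and> (\<forall>b\<in>apex g. h (k b) = b))"

definition id_span :: "'x set \<Rightarrow> ('x, 'x, 'x) span" where
  "id_span X = \<lparr>apex = X, lleg = id, rleg = id\<rparr>"

definition span_comp ::
  "('y, 'z, 'b) span \<Rightarrow> ('x, 'y, 'a) span \<Rightarrow> ('x, 'z, 'a \<times> 'b) span"
  (infixl "\<odot>" 70) where
  "g \<odot> f =
     \<lparr>apex = {(a, b). a \<in> apex f \<and> b \<in> apex g \<and> rleg f a = lleg g b},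
      lleg = lleg f \<circ> fst, rleg = rleg g \<circ> snd\<rparr>"

definition span_prod ::
  "('x, 'y, 'a) span \<Rightarrow> ('x', 'y', 'b) span \<Rightarrow> ('x \<times> 'x', 'y \<times> 'y', 'a \<times> 'b) span"
  (infixl "\<otimes>" 75) where
  "f \<otimes> g =
     \<lparr>apex = apex f \<times> apex g,
      lleg = map_prod (lleg f) (lleg g), rleg = map_prod (rleg f) (rleg g)\<rparr>"

text \<open>Transport of a span along bijections of its feet. It is only used with the structure
  isomorphisms of the Cartesian product, that is, rebracketing and dropping unit factors.\<close>

definition refoot ::
  "('x \<Rightarrow> 'x') \<Rightarrow> ('y \<Rightarrow> 'y') \<Rightarrow> ('x, 'y, 'a) span \<Rightarrow> ('x', 'y', 'a) span" where
  "refoot p q f = \<lparr>apex = apex f, lleg = p \<circ> lleg f, rleg = q \<circ> rleg f\<rparr>"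

text \<open>The canonical 2-morphism from \<open>(id \<otimes> g) \<odot> (f \<otimes> id)\<close> to \<open>(f \<otimes> id) \<odot> (id \<otimes> g)\<close>.\<close>

definition interchanger ::
  "('x, 'x', 'a) span \<Rightarrow> ('y, 'y', 'b) span
     \<Rightarrow> ('a \<times> 'y) \<times> ('x' \<times> 'b) \<Rightarrow> ('x \<times> 'b) \<times> ('a \<times> 'y')" where
  "interchanger f g = (\<lambda>((a, y), (x', b)). ((lleg f a, b), (a, rleg g b)))"


section \<open>The pseudomonoid of a 2-Segal set\<close>

record ('m, 'u, 'a) pseudomonoid =
  carrier :: "'m set"
  unit_span :: "(unit, 'm, 'u) span"
  mult :: "('m \<times> 'm, 'm, 'a) span"
  associator :: "('a \<times> 'm) \<times> 'a \<Rightarrow> ('m \<times> 'a) \<times> 'a"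
  left_unitor :: "('u \<times> 'm) \<times> 'a \<Rightarrow> 'm"
  right_unitor :: "('m \<times> 'u) \<times> 'a \<Rightarrow> 'm"

definition T13 :: "'a presheaf_data \<Rightarrow> 'a \<Rightarrow> 'a \<times> 'a" where
  "T13 X \<psi> = (face X 3 3 \<psi>, face X 3 1 \<psi>)"

definition T02 :: "'a presheaf_data \<Rightarrow> 'a \<Rightarrow> 'a \<times> 'a" where
  "T02 X \<psi> = (face X 3 2 \<psi>, face X 3 0 \<psi>)"

text \<open>In the apex of \<open>mult \<odot> (mult \<otimes> id)\<close> the pair \<open>(\<xi>, \<xi>')\<close> appears as \<open>((\<xi>, d\<^sub>0 \<xi>'), \<xi>')\<close>;
  in the apex of \<open>mult \<odot> (id \<otimes> mult)\<close> it appears as \<open>((d\<^sub>2 \<xi>, \<xi>'), \<xi>)\<close>.\<close>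

definition segal_pseudomonoid :: "'a presheaf_data \<Rightarrow> ('a, 'a, 'a) pseudomonoid" where
  "segal_pseudomonoid X =
     (let \<mu> = \<lparr>apex = ob X 2,
               lleg = (\<lambda>\<psi>. (face X 2 2 \<psi>, face X 2 0 \<psi>)), rleg = face X 2 1\<rparr>;
          \<eta> = \<lparr>apex = ob X 0, lleg = (\<lambda>_. ()), rleg = degen X 0 0\<rparr>
      in \<lparr>carrier = ob X 1, unit_span = \<eta>, mult = \<mu>,
          associator =
            (\<lambda>((\<xi>, _), \<xi>'). case T02 X (inv_into (ob X 3) (T13 X) (\<xi>, \<xi>')) of
               (\<zeta>, \<zeta>') \<Rightarrow> ((face X 2 2 \<zeta>, \<zeta>'), \<zeta>)),
          left_unitor = inv_into (ob X 1) (\<lambda>x. ((face X 1 1 x, x), degen X 1 0 x)),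
          right_unitor = inv_into (ob X 1) (\<lambda>x. ((x, face X 1 0 x), degen X 1 1 x))\<rparr>)"


section \<open>Frobenius structures\<close>

definition z_source ::
  "'m set \<Rightarrow> ('m \<times> 'm, unit, 'a) span \<Rightarrow> (unit, 'm \<times> 'm, 'b) span
     \<Rightarrow> ('m, 'm, ('b \<times> 'm) \<times> ('m \<times> 'a)) span" where
  "z_source M \<alpha> \<beta> =
     refoot snd fst
       ((id_span M \<otimes> \<alpha>) \<odot> refoot id (\<lambda>((x, y), y'). (x, (y, y'))) (\<beta> \<otimes> id_span M))"

definition n_source ::
  "'m set \<Rightarrow> ('m \<times> 'm, unit, 'a) span \<Rightarrow> (unit, 'm \<times> 'm, 'b) span
     \<Rightarrow> ('m, 'm, ('m \<times> 'b) \<times> ('a \<times> 'm)) span" where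
  "n_source M \<alpha> \<beta> =
     refoot fst snd
       ((\<alpha> \<otimes> id_span M) \<odot> refoot id (\<lambda>(x, (y, y')). ((x, y), y')) (id_span M \<otimes> \<beta>))"

text \<open>\<open>id \<otimes> \<beta> \<otimes> id\<close> from \<open>M \<times> M\<close> to \<open>(M \<times> M) \<times> (M \<times> M)\<close>, and
  \<open>id \<otimes> \<alpha> \<otimes> id\<close> in the opposite direction.\<close>

definition middle_beta ::
  "'m set \<Rightarrow> (unit, 'm \<times> 'm, 'b) span
     \<Rightarrow> ('m \<times> 'm, ('m \<times> 'm) \<times> ('m \<times> 'm), ('m \<times> 'b) \<times> 'm) span" where
  "middle_beta M \<beta> =
     refoot (\<lambda>((x, _), w). (x, w)) (\<lambda>((x, (y, y')), w). ((x, y), (y', w)))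
       ((id_span M \<otimes> \<beta>) \<otimes> id_span M)"

definition middle_alpha ::
  "'m set \<Rightarrow> ('m \<times> 'm, unit, 'a) span
     \<Rightarrow> (('m \<times> 'm) \<times> ('m \<times> 'm), 'm \<times> 'm, ('m \<times> 'a) \<times> 'm) span" where
  "middle_alpha M \<alpha> =
     refoot (\<lambda>((x, (y, y')), w). ((x, y), (y', w))) (\<lambda>((x, _), w). (x, w))
       ((id_span M \<otimes> \<alpha>) \<otimes> id_span M)"

text \<open>Condition (i). Both sides are functions from the apex of \<open>axiom1_source\<close> to that of \<open>\<alpha>\<close>.
  In each of them a canonical rebracketing is followed by the whiskered 2-morphism and a unitor
  (the outermost \<open>snd\<close>). The interchange is \<open>interchanger \<alpha> \<alpha>\<close> with the unit object inserted and
  dropped again.\<close>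

definition axiom1_source ::
  "'m set \<Rightarrow> ('m \<times> 'm, unit, 'a) span \<Rightarrow> (unit, 'm \<times> 'm, 'b) span
     \<Rightarrow> ('m \<times> 'm, unit, ((('m \<times> 'b) \<times> 'm) \<times> ('a \<times> ('m \<times> 'm))) \<times> 'a) span" where
  "axiom1_source M \<alpha> \<beta> =
     \<alpha> \<odot> (refoot id snd (\<alpha> \<otimes> id_span (M \<times> M)) \<odot> middle_beta M \<beta>)"

definition axiom1_interchanged ::
  "'m set \<Rightarrow> ('m \<times> 'm, unit, 'a) span \<Rightarrow> (unit, 'm \<times> 'm, 'b) span
     \<Rightarrow> ('m \<times> 'm, unit, ((('m \<times> 'b) \<times> 'm) \<times> (('m \<times> 'm) \<times> 'a)) \<times> 'a) span" where
  "axiom1_interchanged M \<alpha> \<beta> =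
     \<alpha> \<odot> (refoot id fst (id_span (M \<times> M) \<otimes> \<alpha>) \<odot> middle_beta M \<beta>)"

definition axiom1_interchange ::
  "('m \<times> 'm, unit, 'a) span
     \<Rightarrow> ((('m \<times> 'b) \<times> 'm) \<times> ('a \<times> ('m \<times> 'm))) \<times> 'a
     \<Rightarrow> ((('m \<times> 'b) \<times> 'm) \<times> (('m \<times> 'm) \<times> 'a)) \<times> 'a" where
  "axiom1_interchange \<alpha> =
     (\<lambda>((s, t), a). case interchanger \<alpha> \<alpha> (t, ((), a)) of (t', (a', _)) \<Rightarrow> ((s, t'), a'))"

definition axiom1_apply_n ::
  "(('m \<times> 'b) \<times> ('a \<times> 'm) \<Rightarrow> 'm)
     \<Rightarrow> ((('m \<times> 'b) \<times> 'm) \<times> ('a \<times> ('m \<times> 'm))) \<times> 'a \<Rightarrow> 'a" where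
  "axiom1_apply_n n =
     snd \<circ> map_prod (map_prod n id) id \<circ>
       (\<lambda>((((x, b), w), (a, (y, _))), a'). ((((x, b), (a, y)), w), a'))"

definition axiom1_apply_z ::
  "(('b \<times> 'm) \<times> ('m \<times> 'a) \<Rightarrow> 'm)
     \<Rightarrow> ((('m \<times> 'b) \<times> 'm) \<times> (('m \<times> 'm) \<times> 'a)) \<times> 'a \<Rightarrow> 'a" where
  "axiom1_apply_z z =
     snd \<circ> map_prod (map_prod id z) id \<circ>
       (\<lambda>((((x, b), w), ((_, y), a)), a'). ((x, ((b, w), (y, a))), a'))"

text \<open>Condition (ii), with the same conventions; the unitor is now the outermost \<open>fst\<close>.\<close>

definition axiom2_source ::
  "'m set \<Rightarrow> ('m \<times> 'm, unit, 'a) span \<Rightarrow> (unit, 'm \<times> 'm, 'b) span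
     \<Rightarrow> (unit, 'm \<times> 'm, ('b \<times> (('m \<times> 'm) \<times> 'b)) \<times> (('m \<times> 'a) \<times> 'm)) span" where
  "axiom2_source M \<alpha> \<beta> =
     middle_alpha M \<alpha> \<odot> (refoot fst id (id_span (M \<times> M) \<otimes> \<beta>) \<odot> \<beta>)"

definition axiom2_interchanged ::
  "'m set \<Rightarrow> ('m \<times> 'm, unit, 'a) span \<Rightarrow> (unit, 'm \<times> 'm, 'b) span
     \<Rightarrow> (unit, 'm \<times> 'm, ('b \<times> ('b \<times> ('m \<times> 'm))) \<times> (('m \<times> 'a) \<times> 'm)) span" where
  "axiom2_interchanged M \<alpha> \<beta> =
     middle_alpha M \<alpha> \<odot> (refoot snd id (\<beta> \<otimes> id_span (M \<times> M)) \<odot> \<beta>)"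

definition axiom2_interchange ::
  "(unit, 'm \<times> 'm, 'b) span
     \<Rightarrow> ('b \<times> (('m \<times> 'm) \<times> 'b)) \<times> (('m \<times> 'a) \<times> 'm)
     \<Rightarrow> ('b \<times> ('b \<times> ('m \<times> 'm))) \<times> (('m \<times> 'a) \<times> 'm)" where
  "axiom2_interchange \<beta> =
     (\<lambda>((b, t), s). case interchanger \<beta> \<beta> ((b, ()), t) of ((_, b'), t') \<Rightarrow> ((b', t'), s))"

definition axiom2_apply_n ::
  "(('m \<times> 'b) \<times> ('a \<times> 'm) \<Rightarrow> 'm)
     \<Rightarrow> ('b \<times> (('m \<times> 'm) \<times> 'b)) \<times> (('m \<times> 'a) \<times> 'm) \<Rightarrow> 'b" where
  "axiom2_apply_n n =
     fst \<circ> map_prod id (map_prod id n) \<circ>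
       (\<lambda>((b, ((_, y), b')), ((x, a), w)). (b, (x, ((y, b'), (a, w)))))"

definition axiom2_apply_z ::
  "(('b \<times> 'm) \<times> ('m \<times> 'a) \<Rightarrow> 'm)
     \<Rightarrow> ('b \<times> ('b \<times> ('m \<times> 'm))) \<times> (('m \<times> 'a) \<times> 'm) \<Rightarrow> 'b" where
  "axiom2_apply_z z =
     fst \<circ> map_prod id (map_prod z id) \<circ>
       (\<lambda>((b, (b', (y, _))), ((x, a), w)). (b, (((b', y), (x, a)), w)))"

definition biexact_witness ::
  "'m set \<Rightarrow> ('m \<times> 'm, unit, 'a) span \<Rightarrow> (unit, 'm \<times> 'm, 'b) span
     \<Rightarrow> (('b \<times> 'm) \<times> ('m \<times> 'a) \<Rightarrow> 'm) \<Rightarrow> (('m \<times> 'b) \<times> ('a \<times> 'm) \<Rightarrow> 'm) \<Rightarrow> bool" where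
  "biexact_witness M \<alpha> \<beta> z n \<longleftrightarrow>
     is_span {()} (M \<times> M) \<beta> \<and>
     invertible_2mor (z_source M \<alpha> \<beta>) (id_span M) z \<and>
     invertible_2mor (n_source M \<alpha> \<beta>) (id_span M) n \<and>
     (\<forall>s\<in>apex (axiom1_source M \<alpha> \<beta>).
        axiom1_apply_n n s = axiom1_apply_z z (axiom1_interchange \<alpha> s)) \<and>
     (\<forall>s\<in>apex (axiom2_source M \<alpha> \<beta>).
        axiom2_apply_n n s = axiom2_apply_z z (axiom2_interchange \<beta> s))"

text \<open>The apexes of the counit and of its copairing \<open>\<beta>\<close> are sets over a common type \<open>'e\<close>. It plays
  the role of the universe of sets, and it must be large enough to contain a copy of the carrier.\<close>

definition frobenius_structure ::
  "('m, 'u, 'a) pseudomonoid \<Rightarrow> ('m, unit, 'e) span \<Rightarrow> bool" where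
  "frobenius_structure A \<epsilon> \<longleftrightarrow>
     is_span (carrier A) {()} \<epsilon> \<and>
     (\<exists>(\<beta> :: (unit, 'm \<times> 'm, 'e) span) z n.
        biexact_witness (carrier A) (\<epsilon> \<odot> mult A) \<beta> z n)"

definition frobenius_equiv ::
  "('m, 'u, 'a) pseudomonoid \<Rightarrow> (('m, unit, 'e) span \<times> ('m, unit, 'e) span) set" where
  "frobenius_equiv A =
     {(\<epsilon>, \<epsilon>'). frobenius_structure A \<epsilon> \<and> frobenius_structure A \<epsilon>' \<and>
               (\<exists>h. invertible_2mor \<epsilon> \<epsilon>' h)}"

definition frobenius_classes ::
  "('m, 'u, 'a) pseudomonoid \<Rightarrow> ('m, unit, 'e) span set set" where
  "frobenius_classes A = {\<epsilon>. frobenius_structure A \<epsilon>} // frobenius_equiv A"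

end

theory Submission
  imports Defs
begin

text \<open>Both sides of the correspondence amount to the same kind of subset \<open>E\<close> of \<open>X\<^sub>1\<close>: one such that
  both \<open>d\<^sub>2\<close> and \<open>d\<^sub>0\<close> restrict to bijections from \<open>{\<xi> \<in> X\<^sub>2. d\<^sub>1 \<xi> \<in> E}\<close> to \<open>X\<^sub>1\<close>. Such a set is called
  a Frobenius set below.

  Frobenius structures. In \<open>Span\<close>, a pairing \<open>M \<leftarrow> A \<rightarrow> M\<close> has a copairing satisfying the two zigzag
  isomorphisms exactly if both legs are bijections. The coherence conditions (i) and (ii) are then
  automatic, because a span whose legs are jointly injective receives at most one 2-morphism from
  any span. Degenerate 2-simplices show that the leg of the counit \<open>\<epsilon>\<close> of a Frobenius structure is
  injective; so \<open>\<epsilon>\<close> is determined, up to isomorphism, by the image \<open>E\<close> of this leg, and bijectivity of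
  the legs of \<open>\<epsilon> \<circ> \<mu>\<close> says that \<open>E\<close> is a Frobenius set (\<open>frobenius_structure_iff\<close>).

  Paracyclic structures. The rotation of a paracyclic set should turn the vertices \<open>0, \<dots>, n\<close> into
  \<open>1, \<dots>, n + 1\<close>. Given a Frobenius set, an \<open>n\<close>-simplex extends uniquely to an \<open>(n + 1)\<close>-simplex whose
  long edge, from \<open>0\<close> to \<open>n + 1\<close>, lies in \<open>E\<close>: the new triangle on \<open>0, n, n + 1\<close> is unique because \<open>E\<close>
  is a Frobenius set, and the 2-Segal condition glues it on. The same holds for a new vertex on the
  other side (\<open>closings_bij\<close>). Iterating in both directions, an \<open>n\<close>-simplex unrolls uniquely into a
  family of \<open>(n + 1)\<close>-simplices \<open>w\<^sub>k\<close>, \<open>k \<in> \<int>\<close>, with vertices \<open>k, \<dots>, k + n + 1\<close>, which agree on their overlaps.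
  A morphism \<open>f : [m] \<rightarrow> [n]\<close> of the paracyclic category maps \<open>0, \<dots>, m\<close> into one of these windows, and
  acts by restricting the corresponding \<open>w\<^sub>k\<close> along \<open>f\<close>. Functoriality holds because the windows of the
  restricted simplex are themselves restrictions of the \<open>w\<^sub>k\<close>, by uniqueness of the unrolling
  (\<open>paracyclic_structure_extension\<close>).

  Conversely, a paracyclic structure yields \<open>E\<close> as the image of \<open>X\<^sub>0\<close> under the morphism \<open>[1] \<rightarrow> [0]\<close>
  with \<open>0 \<mapsto> 0\<close> and \<open>1 \<mapsto> 1\<close>. A rotation carries a triangle with long edge in \<open>E\<close> to one whose first edge
  is degenerate, and by unitality of 2-Segal sets the latter is itself degenerate; hence \<open>E\<close> is a
  Frobenius set. The two passages are mutually inverse.\<close>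

section \<open>Restricting simplices along vertex maps\<close>

text \<open>Simplicial operators are handled through their values on \<open>{0..m}\<close>; all simplicial identities then
  reduce to pointwise equations between such maps.\<close>

definition vertex_map :: "nat \<Rightarrow> nat \<Rightarrow> (nat \<Rightarrow> nat) \<Rightarrow> bool" where
  "vertex_map m n v \<longleftrightarrow> (\<forall>i\<le>m. v i \<le> n) \<and> (\<forall>i j. i \<le> j \<and> j \<le> m \<longrightarrow> v i \<le> v j)"

definition restrict_along :: "'a presheaf_data \<Rightarrow> nat \<Rightarrow> nat \<Rightarrow> (nat \<Rightarrow> nat) \<Rightarrow> 'a \<Rightarrow> 'a" where
  "restrict_along X m n v = act X m n (periodic m n v)"

lemma paracyclic_homD:
  assumes "f \<in> paracyclic_hom m n"
  shows "i \<le> j \<Longrightarrow> f i \<le> f j" and "f (i + k * (int m + 1)) = f i + k * (int n + 1)"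
  using assms by (auto simp: paracyclic_hom_def monoD)

text \<open>A periodic map is determined by one period.\<close>

lemma paracyclic_hom_eqI:
  assumes f: "f \<in> paracyclic_hom m n" and g: "g \<in> paracyclic_hom m n"
    and eq: "\<And>j. j \<le> m \<Longrightarrow> f (int j) = g (int j)"
  shows "f = g"
proof
  fix i
  define r where "r = i mod (int m + 1)"
  define q where "q = i div (int m + 1)"
  have i: "i = r + q * (int m + 1)" unfolding r_def q_def by (rule mod_div_mult_eq[symmetric])
  have r: "0 \<le> r" "r < int m + 1"
    unfolding r_def by (rule pos_mod_sign pos_mod_bound, simp)+
  have "f r = g r" using eq[of "nat r"] r by simp
  then show "f i = g i" using f g by (simp add: i paracyclic_homD(2))
qed

lemma periodic_of_nat: "j \<le> m \<Longrightarrow> periodic m n v (int j) = int (v j)"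
  by (simp add: periodic_def)

lemma periodic_cong:
  assumes "\<And>j. j \<le> m \<Longrightarrow> v j = w j"
  shows "periodic m n v = periodic m n w"
proof
  fix i
  have "i mod (int m + 1) < int m + 1" by (rule pos_mod_bound) simp
  then have "nat (i mod (int m + 1)) \<le> m" by linarith
  then show "periodic m n v i = periodic m n w i" by (simp add: periodic_def assms)
qed

text \<open>The bound \<open>v m \<le> v 0 + (n + 1)\<close>, rather than \<open>v m \<le> n\<close>, is exactly what monotonicity of the periodic
  extension at the period boundary requires; it also covers morphisms outside the simplex category.\<close>

lemma periodic_paracyclic_hom:
  assumes v: "\<And>i j. i \<le> j \<Longrightarrow> j \<le> m \<Longrightarrow> v i \<le> v j" and le: "v m \<le> v 0 + (n + 1)"
  shows "periodic m n v \<in> paracyclic_hom m n"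
proof -
  have mono: "periodic m n v i \<le> periodic m n v j" if ij: "i \<le> j" for i j
  proof -
    define r s where "r = i mod (int m + 1)" and "s = j mod (int m + 1)"
    define p q where "p = i div (int m + 1)" and "q = j div (int m + 1)"
    have rs: "0 \<le> r" "0 \<le> s" "r < int m + 1" "s < int m + 1"
      unfolding r_def s_def by (rule pos_mod_sign pos_mod_bound, simp)+
    have i: "i = r + p * (int m + 1)" and j: "j = s + q * (int m + 1)"
      unfolding r_def s_def p_def q_def by (rule mod_div_mult_eq[symmetric])+
    have pq: "p \<le> q" unfolding p_def q_def using ij by (simp add: zdiv_mono1)
    have "int (v (nat r)) + p * (int n + 1) \<le> int (v (nat s)) + q * (int n + 1)"
    proof (cases "p = q")
      case True
      then have "r \<le> s" using ij i j by simp
      then show ?thesis using v[of "nat r" "nat s"] rs True by simp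
    next
      case False
      then have "p + 1 \<le> q" using pq by simp
      then have "(p + 1) * (int n + 1) \<le> q * (int n + 1)" by (intro mult_right_mono) auto
      then have "p * (int n + 1) + int n + 1 \<le> q * (int n + 1)" by (simp add: algebra_simps)
      moreover have "v (nat r) \<le> v m" "v 0 \<le> v (nat s)" using v rs by auto
      ultimately show ?thesis using le by linarith
    qed
    then show ?thesis unfolding periodic_def r_def s_def p_def q_def .
  qed
  have "periodic m n v (i + k * (int m + 1)) = periodic m n v i + k * (int n + 1)" for i k
  proof -
    have "(i + k * (int m + 1)) div (int m + 1) = k + i div (int m + 1)"
      by (rule div_mult_self1) simp
    then show ?thesis by (simp only: periodic_def mod_mult_self1) (simp add: algebra_simps)
  qed
  then show ?thesis using mono by (auto simp: paracyclic_hom_def monoI)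
qed

lemma periodic_simplex_hom:
  assumes "vertex_map m n v"
  shows "periodic m n v \<in> simplex_hom m n"
proof -
  have "periodic m n v \<in> paracyclic_hom m n"
    using assms by (intro periodic_paracyclic_hom) (auto simp: vertex_map_def trans_le_add2 le_SucI)
  moreover have "periodic m n v i \<in> {0..int n}" if "i \<in> {0..int m}" for i
  proof -
    have "nat i \<le> m" "i = int (nat i)" using that by auto
    then show ?thesis
      using assms periodic_of_nat[of "nat i" m n v] by (auto simp: vertex_map_def)
  qed
  ultimately show ?thesis by (auto simp: simplex_hom_def)
qed

lemma simplex_hom_periodic:
  assumes "f \<in> simplex_hom m n"
  shows "vertex_map m n (\<lambda>j. nat (f (int j)))"
    and "f = periodic m n (\<lambda>j. nat (f (int j)))"
proof -
  have f: "f \<in> paracyclic_hom m n" and im: "f ` {0..int m} \<subseteq> {0..int n}"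
    using assms by (auto simp: simplex_hom_def)
  have rng: "0 \<le> f (int j) \<and> f (int j) \<le> int n" if "j \<le> m" for j
  proof -
    have "f (int j) \<in> {0..int n}" by (rule subsetD[OF im imageI]) (use that in simp)
    then show ?thesis by simp
  qed
  show v: "vertex_map m n (\<lambda>j. nat (f (int j)))"
    using rng paracyclic_homD(1)[OF f] by (force simp: vertex_map_def intro: nat_mono)
  have "periodic m n (\<lambda>j. nat (f (int j))) \<in> paracyclic_hom m n"
    using periodic_simplex_hom[OF v] by (simp add: simplex_hom_def)
  then show "f = periodic m n (\<lambda>j. nat (f (int j)))"
    by (rule paracyclic_hom_eqI[OF f]) (use rng in \<open>simp add: periodic_of_nat\<close>)
qed

lemma paracyclic_hom_comp:
  assumes "f \<in> paracyclic_hom l m" "g \<in> paracyclic_hom m n"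
  shows "g \<circ> f \<in> paracyclic_hom l n"
  using assms by (auto simp: paracyclic_hom_def mono_def)

lemma restrict_along_cong:
  "(\<And>j. j \<le> m \<Longrightarrow> v j = w j) \<Longrightarrow> restrict_along X m n v x = restrict_along X m n w x"
  unfolding restrict_along_def using periodic_cong[of m v w n] by simp

lemma restrict_along_in:
  assumes "simplicial_set X" "vertex_map m n v" "x \<in> ob X n"
  shows "restrict_along X m n v x \<in> ob X m"
proof -
  have "act X m n (periodic m n v) \<in> ob X n \<rightarrow> ob X m"
    using assms(1) periodic_simplex_hom[OF assms(2)] unfolding simplicial_set_def presheaf_def by blast
  then show ?thesis using assms(3) unfolding restrict_along_def by blast
qed

lemma restrict_along_id:
  assumes "simplicial_set X" "x \<in> ob X n" "\<And>j. j \<le> n \<Longrightarrow> v j = j"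
  shows "restrict_along X n n v x = x"
proof -
  have "vertex_map n n v" using assms(3) by (simp add: vertex_map_def)
  then have "periodic n n v \<in> paracyclic_hom n n"
    using periodic_simplex_hom by (auto simp: simplex_hom_def)
  moreover have "id \<in> paracyclic_hom n n" by (simp add: paracyclic_hom_def mono_def)
  ultimately have "periodic n n v = id"
    by (rule paracyclic_hom_eqI) (simp add: periodic_of_nat assms(3))
  then show ?thesis
    using assms(1,2) by (simp add: restrict_along_def simplicial_set_def presheaf_def)
qed

lemma restrict_along_restrict_along:
  assumes X: "simplicial_set X" and w: "vertex_map l m w" and v: "vertex_map m n v"
    and x: "x \<in> ob X n"
  shows "restrict_along X l m w (restrict_along X m n v x) = restrict_along X l n (\<lambda>j. v (w j)) x"
proof -
  have vw: "vertex_map l n (\<lambda>j. v (w j))" using v w by (simp add: vertex_map_def)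
  note hom = periodic_simplex_hom[OF w] periodic_simplex_hom[OF v] periodic_simplex_hom[OF vw]
  have "periodic m n v \<circ> periodic l m w = periodic l n (\<lambda>j. v (w j))"
  proof (rule paracyclic_hom_eqI)
    show "periodic m n v \<circ> periodic l m w \<in> paracyclic_hom l n"
      using hom by (intro paracyclic_hom_comp) (auto simp: simplex_hom_def)
    show "periodic l n (\<lambda>j. v (w j)) \<in> paracyclic_hom l n"
      using hom by (auto simp: simplex_hom_def)
    show "(periodic m n v \<circ> periodic l m w) (int j) = periodic l n (\<lambda>j. v (w j)) (int j)"
      if "j \<le> l" for j
      using that w by (simp add: periodic_of_nat vertex_map_def)
  qed
  moreover have "act X l n (periodic m n v \<circ> periodic l m w) x
      = act X l m (periodic l m w) (act X m n (periodic m n v) x)"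
    using X hom(1,2) x unfolding simplicial_set_def presheaf_def by blast
  ultimately show ?thesis by (simp add: restrict_along_def)
qed

lemma restrict_along_eqI:
  assumes "simplicial_set X" "x \<in> ob X n"
    and "vertex_map l m w" "vertex_map m n v" "vertex_map l m' w'" "vertex_map m' n v'"
    and "\<And>j. j \<le> l \<Longrightarrow> v (w j) = v' (w' j)"
  shows "restrict_along X l m w (restrict_along X m n v x)
       = restrict_along X l m' w' (restrict_along X m' n v' x)"
  using assms by (simp add: restrict_along_restrict_along cong: restrict_along_cong)

lemma restrict_along_comp:
  assumes "simplicial_set X" "x \<in> ob X n" "vertex_map l m w" "vertex_map m n v"
    and "\<And>j. j \<le> l \<Longrightarrow> v (w j) = u j"
  shows "restrict_along X l m w (restrict_along X m n v x) = restrict_along X l n u x"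
  unfolding restrict_along_restrict_along[OF assms(1,3,4,2)]
  by (rule restrict_along_cong[OF assms(5)])

lemma restrict_along_section:
  assumes "simplicial_set X" "x \<in> ob X n" "vertex_map n m w" "vertex_map m n v"
    and "\<And>j. j \<le> n \<Longrightarrow> v (w j) = j"
  shows "restrict_along X n m w (restrict_along X m n v x) = x"
  unfolding restrict_along_restrict_along[OF assms(1,3,4,2)]
  by (rule restrict_along_id[OF assms(1,2,5)])

lemma face_eq_restrict_along:
  "face X n i = restrict_along X (n - 1) n (\<lambda>j. if j < i then j else j + 1)"
  by (simp add: face_def restrict_along_def)

lemma degen_eq_restrict_along:
  "degen X n i = restrict_along X (n + 1) n (\<lambda>j. if j \<le> i then j else j - 1)"
  by (simp add: degen_def restrict_along_def)

lemma triangle_map_eq_restrict_along: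
  "triangle_map X n (u, v, w) = restrict_along X 2 n (\<lambda>j. [u, v, w] ! j)"
  by (simp add: triangle_map_def restrict_along_def)

lemma act_eq_restrict_along:
  "f \<in> simplex_hom m n \<Longrightarrow> act X m n f = restrict_along X m n (\<lambda>j. nat (f (int j)))"
  unfolding restrict_along_def using simplex_hom_periodic(2) by metis

abbreviation long_edge :: "'a presheaf_data \<Rightarrow> nat \<Rightarrow> 'a \<Rightarrow> 'a" where
  "long_edge X n \<equiv> restrict_along X 1 n (\<lambda>j. j * n)"

section \<open>Gluing a triangle to a simplex\<close>

definition skip :: "nat \<Rightarrow> nat \<Rightarrow> nat" where
  "skip k j = (if j < k then j else j + 1)"

definition skip_triangle :: "nat \<Rightarrow> nat \<times> nat \<times> nat \<Rightarrow> nat \<times> nat \<times> nat" where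
  "skip_triangle k = (\<lambda>(u, v, w). (skip k u, skip k v, skip k w))"

lemma skip_inject [simp]: "skip k i = skip k j \<longleftrightarrow> i = j"
  by (auto simp: skip_def)

lemma less_3_cases: "i < (3::nat) \<Longrightarrow> i = 0 \<or> i = 1 \<or> i = 2"
  by auto

lemma le_2_cases: "i \<le> (2::nat) \<Longrightarrow> i = 0 \<or> i = 1 \<or> i = 2"
  by auto

lemma le_1_cases: "i \<le> (Suc 0) \<Longrightarrow> i = 0 \<or> i = 1"
  by auto

lemma triangle_edge_skip_triangle:
  "i < 3 \<Longrightarrow> triangle_edge (skip_triangle k t) i = map_prod (skip k) (skip k) (triangle_edge t i)"
  by (auto simp: triangle_edge_def skip_triangle_def split: prod.split dest!: less_3_cases)

lemma
  assumes "simplicial_set X" "u \<le> v" "v \<le> w" "w \<le> n" "y \<in> ob X n"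
  shows vertex_map_triangle: "vertex_map 2 n (\<lambda>j. [u, v, w] ! j)"
    and triangle_map_in: "triangle_map X n (u, v, w) y \<in> ob X 2"
    and face_triangle_map: "i < 3 \<Longrightarrow> triangle_edge (u, v, w) i = (a, b) \<Longrightarrow>
      face X 2 i (triangle_map X n (u, v, w) y) = restrict_along X 1 n (\<lambda>j. [a, b] ! j) y"
proof -
  show *: "vertex_map 2 n (\<lambda>j. [u, v, w] ! j)"
    using assms by (auto simp: vertex_map_def dest!: le_2_cases le_1_cases)
  then show "triangle_map X n (u, v, w) y \<in> ob X 2"
    using assms by (simp add: triangle_map_eq_restrict_along restrict_along_in)
  have "vertex_map 1 2 (\<lambda>j. if j < i then j else j + 1)" if "i < 3"
    using that by (auto simp: vertex_map_def)
  then show "face X 2 i (triangle_map X n (u, v, w) y) = restrict_along X 1 n (\<lambda>j. [a, b] ! j) y"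
    if "i < 3" "triangle_edge (u, v, w) i = (a, b)"
    using that assms * unfolding face_eq_restrict_along triangle_map_eq_restrict_along
    by (auto simp: restrict_along_restrict_along triangle_edge_def
        intro!: restrict_along_cong dest!: less_3_cases le_1_cases)
qed

text \<open>If a triangulation of the \<open>(n + 2)\<close>-gon arises from one of the \<open>(n + 1)\<close>-gon by attaching a single
  triangle \<open>t\<^sub>0\<close> that cuts off the vertex \<open>k\<close>, then comparing the 2-Segal bijections for the two
  triangulations exhibits \<open>X\<^sub>n\<^sub>+\<^sub>1\<close> as the fibre product of \<open>X\<^sub>n\<close> and \<open>X\<^sub>2\<close> over \<open>X\<^sub>1\<close>. The edge along which
  \<open>t\<^sub>0\<close> is attached is its \<open>i\<^sub>0\<close>-th edge and the long edge of the simplex \<open>y\<close>.\<close>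

lemma glue_triangle:
  assumes X: "two_segal X" and n: "2 \<le> n" and E: "triangulation n E" and E': "triangulation (n + 1) E'"
    and k: "k \<le> n + 1" and t0: "t0 \<in> triangles E'" "t0 \<notin> skip_triangle k ` triangles E"
    and tri: "triangles E' = insert t0 (skip_triangle k ` triangles E)"
    and shared: "\<And>t i j. t \<in> triangles E \<Longrightarrow> i < 3 \<Longrightarrow> j < 3 \<Longrightarrow>
        triangle_edge t0 i = triangle_edge (skip_triangle k t) j \<Longrightarrow>
        i = i0 \<and> triangle_edge t j = (0, n)"
    and y: "y \<in> ob X n" and \<xi>: "\<xi> \<in> ob X 2" and agree: "face X 2 i0 \<xi> = long_edge X n y"
  shows "\<exists>!\<psi>. \<psi> \<in> ob X (n + 1) \<and> face X (n + 1) k \<psi> = y \<and> triangle_map X (n + 1) t0 \<psi> = \<xi>"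
proof -
  have S: "simplicial_set X" using X by (simp add: two_segal_def)
  let ?T = "\<lambda>\<psi>. \<lambda>t\<in>triangles E. triangle_map X n t \<psi>"
  let ?T' = "\<lambda>\<psi>. \<lambda>t\<in>triangles E'. triangle_map X (n + 1) t \<psi>"
  have bij: "bij_betw ?T (ob X n) (triangulation_families X E)"
    using X n E by (simp add: two_segal_def)
  have bij': "bij_betw ?T' (ob X (n + 1)) (triangulation_families X E')"
    using X n E' by (simp add: two_segal_def)
  have ord: "\<exists>u v w. t = (u, v, w) \<and> u < v \<and> v < w \<and> w \<le> n" if "t \<in> triangles E" for t
    using that E by (auto simp: triangles_def triangulation_def chords_def)
  have ord': "\<exists>u v w. t = (u, v, w) \<and> u < v \<and> v < w \<and> w \<le> n + 1" if "t \<in> triangles E'" for t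
    using that E' by (auto simp: triangles_def triangulation_def chords_def)
  have vskip: "vertex_map n (n + 1) (skip k)"
    using k by (auto simp: vertex_map_def skip_def)
  have face: "face X (n + 1) k = restrict_along X n (n + 1) (skip k)"
    by (simp add: face_eq_restrict_along skip_def[abs_def])
  have tri_face: "triangle_map X n t (face X (n + 1) k \<psi>) = triangle_map X (n + 1) (skip_triangle k t) \<psi>"
    if t: "t \<in> triangles E" and \<psi>: "\<psi> \<in> ob X (n + 1)" for t \<psi>
  proof -
    obtain u v w where uvw: "t = (u, v, w)" "u < v" "v < w" "w \<le> n" using ord[OF t] by blast
    have vt: "vertex_map 2 n (\<lambda>j. [u, v, w] ! j)"
      using uvw by (auto simp: vertex_map_def dest!: le_2_cases le_1_cases)
    show ?thesis
      unfolding face uvw triangle_map_eq_restrict_along skip_triangle_def prod.case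
        restrict_along_restrict_along[OF S vt vskip \<psi>]
      by (rule restrict_along_cong) (auto dest!: le_2_cases)
  qed
  \<comment> \<open>An \<open>n\<close>-simplex is determined by its triangles in \<open>E\<close>, so the face can be recognised from them.\<close>
  have determined: "face X (n + 1) k \<psi> = y" if \<psi>: "\<psi> \<in> ob X (n + 1)"
    and "\<And>t. t \<in> triangles E \<Longrightarrow> triangle_map X (n + 1) (skip_triangle k t) \<psi> = triangle_map X n t y" for \<psi>
  proof (rule inj_onD[OF bij_betw_imp_inj_on[OF bij]])
    show "?T (face X (n + 1) k \<psi>) = ?T y" by (rule restrict_ext) (simp only: tri_face that)
    show "face X (n + 1) k \<psi> \<in> ob X n" unfolding face using restrict_along_in[OF S vskip \<psi>] .
  qed (rule y)
  have inj_skip: "inj (skip_triangle k)" by (auto simp: inj_def skip_triangle_def)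
  \<comment> \<open>The family to be assembled: \<open>\<xi>\<close> on the new triangle and the triangles of \<open>y\<close> on the old ones.\<close>
  define \<zeta> where "\<zeta> = (\<lambda>t\<in>triangles E'. if t = t0 then \<xi> else triangle_map X n (inv (skip_triangle k) t) y)"
  have \<zeta>0: "\<zeta> t0 = \<xi>" using t0 by (simp add: \<zeta>_def)
  have \<zeta>s: "\<zeta> (skip_triangle k t) = triangle_map X n t y" if "t \<in> triangles E" for t
    using that t0 tri inj_skip by (auto simp: \<zeta>_def)
  have edge: "face X 2 i (\<zeta> (skip_triangle k t)) = restrict_along X 1 n (\<lambda>j. [a, b] ! j) y"
    if t: "t \<in> triangles E" "i < 3" "triangle_edge t i = (a, b)" for t i a b
  proof -
    obtain u v w where uvw: "t = (u, v, w)" "u < v" "v < w" "w \<le> n" using ord[OF t(1)] by blast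
    show ?thesis unfolding \<zeta>s[OF t(1)] using uvw that y by (simp add: face_triangle_map[OF S])
  qed
  have mixed: "face X 2 i (\<zeta> t0) = face X 2 j (\<zeta> (skip_triangle k t))"
    if "t \<in> triangles E" "i < 3" "j < 3" "triangle_edge t0 i = triangle_edge (skip_triangle k t) j" for t i j
  proof -
    have "i = i0" "triangle_edge t j = (0, n)" using shared[OF that] by auto
    then have "face X 2 j (\<zeta> (skip_triangle k t)) = restrict_along X 1 n (\<lambda>j. [0, n] ! j) y"
      using edge that by blast
    also have "\<dots> = long_edge X n y" by (rule restrict_along_cong) (auto dest!: le_1_cases)
    finally show ?thesis using \<zeta>0 agree \<open>i = i0\<close> by simp
  qed
  have "\<zeta> \<in> triangulation_families X E'"
  proof -
    have "\<zeta> t \<in> ob X 2" if t: "t \<in> triangles E'" for t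
    proof (cases "t = t0")
      case True then show ?thesis using \<zeta>0 \<xi> by simp
    next
      case False
      then obtain s where s: "s \<in> triangles E" "t = skip_triangle k s" using t tri by auto
      obtain u v w where uvw: "s = (u, v, w)" "u < v" "v < w" "w \<le> n" using ord[OF s(1)] by blast
      show ?thesis using \<zeta>s[OF s(1)] s uvw y by (simp add: triangle_map_in[OF S])
    qed
    then have pie: "\<zeta> \<in> triangles E' \<rightarrow>\<^sub>E ob X 2" by (simp add: \<zeta>_def)
    have compat: "face X 2 i (\<zeta> t) = face X 2 j (\<zeta> t')"
      if t: "t \<in> triangles E'" "t' \<in> triangles E'" and ij: "i < 3" "j < 3"
        and eq: "triangle_edge t i = triangle_edge t' j" for t t' i j
    proof -
      consider "t = t0" "t' = t0"
        | s where "t = t0" "s \<in> triangles E" "t' = skip_triangle k s"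
        | s where "t' = t0" "s \<in> triangles E" "t = skip_triangle k s"
        | s s' where "s \<in> triangles E" "t = skip_triangle k s" "s' \<in> triangles E" "t' = skip_triangle k s'"
        using t unfolding tri by blast
      then show ?thesis
      proof cases
        case 1
        then have "i = j"
          using eq ij ord'[OF t(1)] by (auto simp: triangle_edge_def dest!: less_3_cases)
        then show ?thesis using 1 by simp
      next
        case 2 then show ?thesis using mixed eq ij by simp
      next
        case 3 then show ?thesis using mixed[of s j i] eq ij by simp
      next
        case 4
        obtain a b where ab: "triangle_edge s i = (a, b)" by fastforce
        have "map_prod (skip k) (skip k) (triangle_edge s i) = map_prod (skip k) (skip k) (triangle_edge s' j)"
          using eq 4 ij by (simp add: triangle_edge_skip_triangle)
        then have "triangle_edge s' j = (a, b)" using ab by (cases "triangle_edge s' j") auto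
        then show ?thesis using edge 4 ab ij by simp
      qed
    qed
    show ?thesis
      unfolding triangulation_families_def mem_Collect_eq
      using pie compat by (intro conjI ballI allI impI)
  qed
  then obtain \<psi> where \<psi>: "\<psi> \<in> ob X (n + 1)" "?T' \<psi> = \<zeta>"
    using bij' unfolding bij_betw_def by (metis (no_types, lifting) imageE)
  have T': "triangle_map X (n + 1) t \<psi> = \<zeta> t" if "t \<in> triangles E'" for t
    using fun_cong[OF \<psi>(2), of t] that by simp
  show ?thesis
  proof (rule ex1I[of _ \<psi>])
    show "\<psi> \<in> ob X (n + 1) \<and> face X (n + 1) k \<psi> = y \<and> triangle_map X (n + 1) t0 \<psi> = \<xi>"
    proof (intro conjI)
      show "face X (n + 1) k \<psi> = y"
        by (rule determined[OF \<psi>(1)]) (metis T' \<zeta>s tri imageI insertI2)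
      show "triangle_map X (n + 1) t0 \<psi> = \<xi>"
        using T'[OF t0(1)] \<zeta>0 by simp
    qed (rule \<psi>(1))
  next
    fix \<phi> assume \<phi>: "\<phi> \<in> ob X (n + 1) \<and> face X (n + 1) k \<phi> = y \<and> triangle_map X (n + 1) t0 \<phi> = \<xi>"
    have "triangle_map X (n + 1) t \<phi> = \<zeta> t" if "t \<in> triangles E'" for t
    proof (cases "t = t0")
      case True then show ?thesis using \<phi> \<zeta>0 by simp
    next
      case False
      then obtain s where s: "s \<in> triangles E" "t = skip_triangle k s" using \<open>t \<in> triangles E'\<close> tri by auto
      show ?thesis using tri_face[OF s(1), of \<phi>] \<zeta>s[OF s(1)] \<phi> s(2) by simp
    qed
    then have "?T' \<phi> = ?T' \<psi>" by (intro restrict_ext) (simp only: T')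
    then show "\<phi> = \<psi>"
      by (rule inj_onD[OF bij_betw_imp_inj_on[OF bij']]) (rule conjunct1[OF \<phi>] \<psi>(1))+
  qed
qed

text \<open>The triangulations of the polygon all of whose triangles contain the vertex \<open>0\<close>, respectively \<open>n\<close>.
  Adding the last, respectively the first, vertex of the next larger polygon extends them by one
  triangle.\<close>

definition first_fan :: "nat \<Rightarrow> (nat \<times> nat) set" where
  "first_fan n = {(a, b). a < b \<and> b \<le> n \<and> (a = 0 \<or> b = a + 1)}"

definition last_fan :: "nat \<Rightarrow> (nat \<times> nat) set" where
  "last_fan n = {(a, b). a < b \<and> b \<le> n \<and> (b = n \<or> b = a + 1)}"

lemma triangulation_first_fan: "triangulation n (first_fan n)"
proof -
  have "(a, b) \<in> first_fan n" if ab: "a < b" "b \<le> n"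
    and nc: "\<And>e. e \<in> first_fan n \<Longrightarrow> \<not> crossing (a, b) e" for a b
  proof (rule ccontr)
    assume "(a, b) \<notin> first_fan n"
    then have "0 < a" "a + 1 < b" using ab by (auto simp: first_fan_def)
    then show False using nc[of "(0, a + 1)"] ab by (auto simp: first_fan_def crossing_def)
  qed
  then show ?thesis
    by (auto simp: triangulation_def chords_def) (auto simp: first_fan_def crossing_def)
qed

lemma triangulation_last_fan: "triangulation n (last_fan n)"
proof -
  have "(a, b) \<in> last_fan n" if ab: "a < b" "b \<le> n"
    and nc: "\<And>e. e \<in> last_fan n \<Longrightarrow> \<not> crossing (a, b) e" for a b
  proof (rule ccontr)
    assume "(a, b) \<notin> last_fan n"
    then have "b < n" "a + 1 < b" using ab by (auto simp: last_fan_def)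
    then show False using nc[of "(a + 1, n)"] ab by (auto simp: last_fan_def crossing_def)
  qed
  then show ?thesis
    by (auto simp: triangulation_def chords_def) (auto simp: last_fan_def crossing_def)
qed

lemma triangles_first_fan: "triangles (first_fan n) = {(0, v, v + 1) | v. 0 < v \<and> v < n}"
  by (auto simp: triangles_def first_fan_def)

lemma triangles_last_fan: "triangles (last_fan n) = {(u, u + 1, n) | u. u + 1 < n}"
  by (auto simp: triangles_def last_fan_def)

lemma glue_triangle_last:
  assumes "two_segal X" "2 \<le> n" "y \<in> ob X n" "\<xi> \<in> ob X 2" "face X 2 2 \<xi> = long_edge X n y"
  shows "\<exists>!\<psi>. \<psi> \<in> ob X (n + 1) \<and> face X (n + 1) (n + 1) \<psi> = y \<and> triangle_map X (n + 1) (0, n, n + 1) \<psi> = \<xi>"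
proof (rule glue_triangle[OF assms(1,2) triangulation_first_fan triangulation_first_fan _ _ _ _ _ assms(3-5)])
  have img: "skip_triangle (n + 1) ` triangles (first_fan n) = triangles (first_fan n)"
    unfolding triangles_first_fan image_def skip_triangle_def skip_def by force
  show "(0, n, n + 1) \<in> triangles (first_fan (n + 1))"
    "(0, n, n + 1) \<notin> skip_triangle (n + 1) ` triangles (first_fan n)"
    "triangles (first_fan (n + 1)) = insert (0, n, n + 1) (skip_triangle (n + 1) ` triangles (first_fan n))"
    using assms(2) unfolding img by (auto simp: triangles_first_fan)
  show "i = 2 \<and> triangle_edge t j = (0, n)"
    if "t \<in> triangles (first_fan n)" "i < 3" "j < 3"
      "triangle_edge (0, n, n + 1) i = triangle_edge (skip_triangle (n + 1) t) j" for t i j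
    using that assms(2)
    by (auto simp: triangles_first_fan triangle_edge_def skip_triangle_def skip_def dest!: less_3_cases)
qed simp

lemma glue_triangle_first:
  assumes "two_segal X" "2 \<le> n" "y \<in> ob X n" "\<xi> \<in> ob X 2" "face X 2 0 \<xi> = long_edge X n y"
  shows "\<exists>!\<psi>. \<psi> \<in> ob X (n + 1) \<and> face X (n + 1) 0 \<psi> = y \<and> triangle_map X (n + 1) (0, 1, n + 1) \<psi> = \<xi>"
proof (rule glue_triangle[OF assms(1,2) triangulation_last_fan triangulation_last_fan _ _ _ _ _ assms(3-5)])
  have img: "skip_triangle 0 ` triangles (last_fan n) = {(u + 1, u + 2, n + 1) | u. u + 1 < n}"
    unfolding triangles_last_fan image_def skip_triangle_def skip_def by force
  show "(0, 1, n + 1) \<in> triangles (last_fan (n + 1))"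
    "(0, 1, n + 1) \<notin> skip_triangle 0 ` triangles (last_fan n)"
    using assms(2) unfolding img by (auto simp: triangles_last_fan)
  have "(u, u + 1, n + 1) = (0, 1, n + 1) \<or> (\<exists>u'. (u, u + 1, n + 1) = (u' + 1, u' + 2, n + 1) \<and> u' + 1 < n)"
    if "u + 1 < n + 1" for u
    using that by (cases u) auto
  then have "{(u, u + 1, n + 1) | u. u + 1 < n + 1}
      = insert (0, 1, n + 1) {(u + 1, u + 2, n + 1) | u. u + 1 < n}"
    using assms(2) by auto
  then show "triangles (last_fan (n + 1)) = insert (0, 1, n + 1) (skip_triangle 0 ` triangles (last_fan n))"
    unfolding img by (simp only: triangles_last_fan)
  show "i = 0 \<and> triangle_edge t j = (0, n)"
    if "t \<in> triangles (last_fan n)" "i < 3" "j < 3"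
      "triangle_edge (0, 1, n + 1) i = triangle_edge (skip_triangle 0 t) j" for t i j
    using that assms(2)
    by (auto simp: triangles_last_fan triangle_edge_def skip_triangle_def skip_def dest!: less_3_cases)
qed simp


text \<open>Unitality of 2-Segal sets. The degeneracies \<open>s\<^sub>0 \<xi>\<close> and \<open>s\<^sub>1 \<xi>\<close> have the same triangle on the vertices
  \<open>0, 2, 3\<close>, namely \<open>\<xi>\<close>, and since \<open>d\<^sub>2 \<xi>\<close> is degenerate they also have the same triangle on \<open>0, 1, 2\<close>.
  Hence they coincide, and taking \<open>d\<^sub>0\<close> gives the claim.\<close>

lemma degenerate_of_first_edge:
  assumes X: "two_segal X" and \<xi>: "\<xi> \<in> ob X 2" and u: "u \<in> ob X 0"
    and deg: "face X 2 2 \<xi> = degen X 0 0 u"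
  shows "degen X 1 0 (face X 2 0 \<xi>) = \<xi>"
proof -
  have S: "simplicial_set X" using X by (simp add: two_segal_def)
  let ?s0 = "degen X 2 0 \<xi>" and ?s1 = "degen X 2 1 \<xi>"
  have in3: "?s0 \<in> ob X 3" "?s1 \<in> ob X 3"
    using \<xi> by (auto simp: degen_eq_restrict_along vertex_map_def intro!: restrict_along_in[OF S])
  have in2: "face X 3 3 ?s0 \<in> ob X 2"
    using in3 by (auto simp: face_eq_restrict_along vertex_map_def intro!: restrict_along_in[OF S])
  have "face X 3 3 ?s0 = restrict_along X 2 1 (\<lambda>j. j - 1) (face X 2 2 \<xi>)"
    by (simp add: face_eq_restrict_along degen_eq_restrict_along)
      (rule restrict_along_eqI[OF S \<xi>]; auto simp: vertex_map_def)
  also have "\<dots> = restrict_along X 2 1 (\<lambda>j. min j 1) (face X 2 2 \<xi>)"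
    by (simp add: deg degen_eq_restrict_along)
      (rule restrict_along_eqI[OF S u]; auto simp: vertex_map_def)
  also have "\<dots> = face X 3 3 ?s1"
    by (simp add: face_eq_restrict_along degen_eq_restrict_along)
      (rule restrict_along_eqI[OF S \<xi>]; auto simp: vertex_map_def)
  finally have faces: "face X 3 3 ?s0 = face X 3 3 ?s1" .
  have tri: "triangle_map X 3 (0, 2, 3) ?s0 = \<xi>" "triangle_map X 3 (0, 2, 3) ?s1 = \<xi>"
    by (simp add: triangle_map_eq_restrict_along degen_eq_restrict_along,
        rule restrict_along_section[OF S \<xi>]; auto simp: vertex_map_def dest!: le_1_cases le_2_cases)+
  have "long_edge X 2 (face X 3 3 ?s0) = restrict_along X 1 3 (\<lambda>j. j * 2) ?s0"
    by (simp add: face_eq_restrict_along)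
      (rule restrict_along_comp[OF S in3(1)]; auto simp: vertex_map_def dest!: le_1_cases)
  also have "\<dots> = face X 2 2 \<xi>"
    by (simp add: face_eq_restrict_along degen_eq_restrict_along)
      (rule restrict_along_comp[OF S \<xi>]; auto simp: vertex_map_def dest!: le_1_cases)
  finally have "face X 2 2 \<xi> = long_edge X 2 (face X 3 3 ?s0)" by (rule sym)
  from glue_triangle_last[OF X _ in2 \<xi> this] have "?s0 = ?s1"
    using in3 tri faces by auto
  moreover have "face X 3 0 ?s0 = \<xi>"
    by (simp add: face_eq_restrict_along degen_eq_restrict_along)
      (rule restrict_along_section[OF S \<xi>]; auto simp: vertex_map_def)
  moreover have "face X 3 0 ?s1 = degen X 1 0 (face X 2 0 \<xi>)"
    by (simp add: face_eq_restrict_along degen_eq_restrict_along numeral_2_eq_2[symmetric])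
      (rule restrict_along_eqI[OF S \<xi>]; auto simp: vertex_map_def)
  ultimately show ?thesis by simp
qed

section \<open>Closing a simplex up with an edge from a given set\<close>

text \<open>The ways to close an \<open>n\<close>-simplex up, by one further vertex, with an edge from \<open>E\<close>.\<close>

definition closings :: "'a presheaf_data \<Rightarrow> 'a set \<Rightarrow> nat \<Rightarrow> 'a set" where
  "closings X E n = {\<psi> \<in> ob X (n + 1). long_edge X (n + 1) \<psi> \<in> E}"

text \<open>The condition on the image of a counit that is equivalent to biexactness of its pairing; see
  \<open>frobenius_structure_iff\<close>.\<close>

definition frobenius_set :: "'a presheaf_data \<Rightarrow> 'a set \<Rightarrow> bool" where
  "frobenius_set X E \<longleftrightarrow> E \<subseteq> ob X 1 \<and>
     bij_betw (face X 2 2) (closings X E 1) (ob X 1) \<and>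
     bij_betw (face X 2 0) (closings X E 1) (ob X 1)"

lemma bij_betw_ex1I:
  assumes "\<And>x. x \<in> A \<Longrightarrow> f x \<in> B" "\<And>y. y \<in> B \<Longrightarrow> \<exists>!x. x \<in> A \<and> f x = y"
  shows "bij_betw f A B"
  unfolding bij_betw_def
proof
  show "inj_on f A" using assms by (metis inj_onI)
  show "f ` A = B" using assms by blast
qed

lemma bij_betw_ex1:
  "bij_betw f A B \<Longrightarrow> y \<in> B \<Longrightarrow> \<exists>!x. x \<in> A \<and> f x = y"
  unfolding bij_betw_def inj_on_def by blast

lemma end_faces_in:
  assumes "simplicial_set X" "\<psi> \<in> ob X (n + 1)"
  shows "face X (n + 1) 0 \<psi> \<in> ob X n" and "face X (n + 1) (n + 1) \<psi> \<in> ob X n"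
  using assms by (auto simp: face_eq_restrict_along vertex_map_def intro!: restrict_along_in)

text \<open>The Frobenius condition supplies a unique triangle over the long edge of the given \<open>n\<close>-simplex, and
  gluing this triangle on supplies the closing.\<close>

lemma closings_bij_ge_2:
  assumes X: "two_segal X" and E: "frobenius_set X E" and n: "2 \<le> n"
  shows "bij_betw (face X (n + 1) (n + 1)) (closings X E n) (ob X n)"
    and "bij_betw (face X (n + 1) 0) (closings X E n) (ob X n)"
proof -
  have S: "simplicial_set X" using X by (simp add: two_segal_def)
  have b1: "bij_betw (face X 2 2) (closings X E 1) (ob X 1)"
    and b2: "bij_betw (face X 2 0) (closings X E 1) (ob X 1)"
    using E by (auto simp: frobenius_set_def)
  have long: "long_edge X n y \<in> ob X 1" if "y \<in> ob X n" for y
    using that by (auto simp: vertex_map_def intro!: restrict_along_in[OF S])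
  have tri_in: "triangle_map X (n + 1) (0, n, n + 1) \<psi> \<in> ob X 2"
    "triangle_map X (n + 1) (0, 1, n + 1) \<psi> \<in> ob X 2" if "\<psi> \<in> ob X (n + 1)" for \<psi>
    using that by (auto intro!: triangle_map_in[OF S])
  have long_tri: "long_edge X 2 (triangle_map X (n + 1) (0, v, n + 1) \<psi>) = long_edge X (n + 1) \<psi>"
    if "v \<le> n + 1" "\<psi> \<in> ob X (n + 1)" for v \<psi>
    using that unfolding triangle_map_eq_restrict_along
    by (subst restrict_along_restrict_along[OF S])
      (auto simp: vertex_map_triangle[OF S] vertex_map_def intro!: restrict_along_cong
        dest!: le_1_cases le_2_cases)
  have first_tri: "face X 2 2 (triangle_map X (n + 1) (0, n, n + 1) \<psi>) = long_edge X n (face X (n + 1) (n + 1) \<psi>)"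
    if "\<psi> \<in> ob X (n + 1)" for \<psi>
    using n unfolding triangle_map_eq_restrict_along face_eq_restrict_along
    by simp (rule restrict_along_eqI[OF S that[simplified]];
        auto simp: vertex_map_def dest!: le_1_cases le_2_cases)
  have last_tri: "face X 2 0 (triangle_map X (n + 1) (0, 1, n + 1) \<psi>) = long_edge X n (face X (n + 1) 0 \<psi>)"
    if "\<psi> \<in> ob X (n + 1)" for \<psi>
    using n unfolding triangle_map_eq_restrict_along face_eq_restrict_along
    by simp (rule restrict_along_eqI[OF S that[simplified]];
        auto simp: vertex_map_def dest!: le_1_cases le_2_cases)
  show "bij_betw (face X (n + 1) (n + 1)) (closings X E n) (ob X n)"
  proof (rule bij_betw_ex1I)
    show "face X (n + 1) (n + 1) \<psi> \<in> ob X n" if "\<psi> \<in> closings X E n" for \<psi>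
      using that by (simp add: closings_def end_faces_in[OF S, simplified])
    fix y assume y: "y \<in> ob X n"
    obtain \<xi> where \<xi>: "\<xi> \<in> closings X E 1" "face X 2 2 \<xi> = long_edge X n y"
      and uniq: "\<And>\<xi>'. \<xi>' \<in> closings X E 1 \<Longrightarrow> face X 2 2 \<xi>' = long_edge X n y \<Longrightarrow> \<xi>' = \<xi>"
      using bij_betw_ex1[OF b1 long[OF y]] by blast
    have \<xi>2: "\<xi> \<in> ob X 2" "long_edge X 2 \<xi> \<in> E" using \<xi>(1) by (auto simp: closings_def numeral_2_eq_2)
    have glue: "\<exists>!\<psi>. \<psi> \<in> ob X (n + 1) \<and> face X (n + 1) (n + 1) \<psi> = y
        \<and> triangle_map X (n + 1) (0, n, n + 1) \<psi> = \<xi>"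
      by (rule glue_triangle_last[OF X n y \<xi>2(1) \<xi>(2)])
    show "\<exists>!\<psi>. \<psi> \<in> closings X E n \<and> face X (n + 1) (n + 1) \<psi> = y"
    proof -
      have "triangle_map X (n + 1) (0, n, n + 1) \<psi> = \<xi>"
        if "\<psi> \<in> closings X E n" "face X (n + 1) (n + 1) \<psi> = y" for \<psi>
        using that n tri_in first_tri long_tri[of n \<psi>]
        by (intro uniq) (auto simp: closings_def numeral_2_eq_2)
      moreover have "\<psi> \<in> closings X E n"
        if "\<psi> \<in> ob X (n + 1)" "triangle_map X (n + 1) (0, n, n + 1) \<psi> = \<xi>" for \<psi>
        using that long_tri[of n \<psi>] \<xi>2 by (simp add: closings_def)
      moreover have "\<psi> \<in> ob X (n + 1)" if "\<psi> \<in> closings X E n" for \<psi>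
        using that by (simp add: closings_def)
      ultimately show ?thesis using glue by metis
    qed
  qed
  show "bij_betw (face X (n + 1) 0) (closings X E n) (ob X n)"
  proof (rule bij_betw_ex1I)
    show "face X (n + 1) 0 \<psi> \<in> ob X n" if "\<psi> \<in> closings X E n" for \<psi>
      using that by (simp add: closings_def end_faces_in[OF S, simplified])
    fix y assume y: "y \<in> ob X n"
    obtain \<xi> where \<xi>: "\<xi> \<in> closings X E 1" "face X 2 0 \<xi> = long_edge X n y"
      and uniq: "\<And>\<xi>'. \<xi>' \<in> closings X E 1 \<Longrightarrow> face X 2 0 \<xi>' = long_edge X n y \<Longrightarrow> \<xi>' = \<xi>"
      using bij_betw_ex1[OF b2 long[OF y]] by blast
    have \<xi>2: "\<xi> \<in> ob X 2" "long_edge X 2 \<xi> \<in> E" using \<xi>(1) by (auto simp: closings_def numeral_2_eq_2)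
    have glue: "\<exists>!\<psi>. \<psi> \<in> ob X (n + 1) \<and> face X (n + 1) 0 \<psi> = y
        \<and> triangle_map X (n + 1) (0, 1, n + 1) \<psi> = \<xi>"
      by (rule glue_triangle_first[OF X n y \<xi>2(1) \<xi>(2)])
    show "\<exists>!\<psi>. \<psi> \<in> closings X E n \<and> face X (n + 1) 0 \<psi> = y"
    proof -
      have "triangle_map X (n + 1) (0, 1, n + 1) \<psi> = \<xi>"
        if "\<psi> \<in> closings X E n" "face X (n + 1) 0 \<psi> = y" for \<psi>
        using that n tri_in last_tri long_tri[of 1 \<psi>]
        by (intro uniq) (auto simp: closings_def numeral_2_eq_2)
      moreover have "\<psi> \<in> closings X E n"
        if "\<psi> \<in> ob X (n + 1)" "triangle_map X (n + 1) (0, 1, n + 1) \<psi> = \<xi>" for \<psi>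
        using that long_tri[of 1 \<psi>] \<xi>2 by (simp add: closings_def)
      moreover have "\<psi> \<in> ob X (n + 1)" if "\<psi> \<in> closings X E n" for \<psi>
        using that by (simp add: closings_def)
      ultimately show ?thesis using glue by metis
    qed
  qed
qed

lemma closings_0:
  assumes "simplicial_set X" "E \<subseteq> ob X 1"
  shows "closings X E 0 = E"
proof -
  have "long_edge X (0 + 1) \<psi> = \<psi>" if "\<psi> \<in> ob X 1" for \<psi>
    using that by (auto intro!: restrict_along_id[OF assms(1)])
  then show ?thesis using assms(2) by (auto simp: closings_def)
qed

text \<open>Each \<open>e \<in> E\<close> is the long edge of the triangle \<open>s\<^sub>0 e\<close>, whose first edge is the degenerate edge at the
  source of \<open>e\<close>. The Frobenius condition for degenerate edges therefore says that every vertex is the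
  source of exactly one member of \<open>E\<close>; dually, with \<open>s\<^sub>1 e\<close>, for targets.\<close>

lemma closings_bij_0:
  assumes S: "simplicial_set X" and E: "frobenius_set X E"
  shows "bij_betw (face X 1 1) (closings X E 0) (ob X 0)"
    and "bij_betw (face X 1 0) (closings X E 0) (ob X 0)"
proof -
  have E1: "E \<subseteq> ob X 1" and b: "bij_betw (face X 2 2) (closings X E 1) (ob X 1)"
      "bij_betw (face X 2 0) (closings X E 1) (ob X 1)"
    using E by (auto simp: frobenius_set_def)
  have c0: "closings X E 0 = E" by (rule closings_0[OF S E1])
  have deg: "degen X 0 0 u \<in> ob X 1" if "u \<in> ob X 0" for u
    using that by (auto simp: degen_eq_restrict_along vertex_map_def intro!: restrict_along_in[OF S])
  have s: "degen X 1 i e \<in> closings X E 1" "long_edge X 2 (degen X 1 i e) = e"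
    if "e \<in> E" "i \<le> 1" for e i
  proof -
    have e: "e \<in> ob X 1" using that E1 by blast
    then have "degen X 1 i e \<in> ob X (1 + 1)"
      using that(2) by (auto simp: degen_eq_restrict_along vertex_map_def intro!: restrict_along_in[OF S])
    moreover show "long_edge X 2 (degen X 1 i e) = e"
      using that(2) by (simp add: degen_eq_restrict_along numeral_2_eq_2[symmetric])
        (rule restrict_along_section[OF S e[simplified]]; auto simp: vertex_map_def dest!: le_1_cases)
    ultimately show "degen X 1 i e \<in> closings X E 1"
      using that by (simp add: closings_def numeral_2_eq_2)
  qed
  have s_face: "face X 2 2 (degen X 1 0 e) = degen X 0 0 (face X 1 1 e)"
    "face X 2 0 (degen X 1 1 e) = degen X 0 0 (face X 1 0 e)" if "e \<in> ob X 1" for e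
    by (simp add: face_eq_restrict_along degen_eq_restrict_along numeral_2_eq_2[symmetric],
        rule restrict_along_eqI[OF S that[simplified]]; auto simp: vertex_map_def dest!: le_1_cases)+
  have v_face: "face X 1 1 (long_edge X 2 \<xi>) = face X 1 1 (face X 2 2 \<xi>)"
    "face X 1 0 (long_edge X 2 \<xi>) = face X 1 0 (face X 2 0 \<xi>)" if "\<xi> \<in> ob X 2" for \<xi>
    by (simp add: face_eq_restrict_along,
        rule restrict_along_eqI[OF S that]; auto simp: vertex_map_def dest!: le_1_cases)+
  have d_face: "face X 1 i (degen X 0 0 u) = u" if "u \<in> ob X 0" "i \<le> 1" for u i
    using that(2) by (simp add: face_eq_restrict_along degen_eq_restrict_along)
      (rule restrict_along_section[OF S that(1)]; auto simp: vertex_map_def)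
  have cl: "\<xi> \<in> ob X 2" "long_edge X 2 \<xi> \<in> E" if "\<xi> \<in> closings X E 1" for \<xi>
    using that by (auto simp: closings_def numeral_2_eq_2)
  have face_in: "face X 1 i e \<in> ob X 0" if "e \<in> E" for i e
    using that E1 by (auto simp: face_eq_restrict_along vertex_map_def intro!: restrict_along_in[OF S])
  show "bij_betw (face X 1 1) (closings X E 0) (ob X 0)"
    unfolding c0
  proof (rule bij_betw_ex1I)
    fix u assume u: "u \<in> ob X 0"
    obtain \<xi> where \<xi>: "\<xi> \<in> closings X E 1" "face X 2 2 \<xi> = degen X 0 0 u"
      and uniq: "\<And>\<xi>'. \<xi>' \<in> closings X E 1 \<Longrightarrow> face X 2 2 \<xi>' = degen X 0 0 u \<Longrightarrow> \<xi>' = \<xi>"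
      using bij_betw_ex1[OF b(1) deg[OF u]] by blast
    show "\<exists>!e. e \<in> E \<and> face X 1 1 e = u"
    proof (rule ex1I[of _ "long_edge X 2 \<xi>"])
      show "long_edge X 2 \<xi> \<in> E \<and> face X 1 1 (long_edge X 2 \<xi>) = u"
        using cl[OF \<xi>(1)] v_face(1) \<xi>(2) d_face[OF u] by simp
      fix e assume e: "e \<in> E \<and> face X 1 1 e = u"
      then have "degen X 1 0 e = \<xi>" using s(1)[of e 0] s_face(1)[of e] E1 by (intro uniq) auto
      then show "e = long_edge X 2 \<xi>" using s(2)[of e 0] e by simp
    qed
  qed (rule face_in)
  show "bij_betw (face X 1 0) (closings X E 0) (ob X 0)"
    unfolding c0
  proof (rule bij_betw_ex1I)
    fix u assume u: "u \<in> ob X 0"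
    obtain \<xi> where \<xi>: "\<xi> \<in> closings X E 1" "face X 2 0 \<xi> = degen X 0 0 u"
      and uniq: "\<And>\<xi>'. \<xi>' \<in> closings X E 1 \<Longrightarrow> face X 2 0 \<xi>' = degen X 0 0 u \<Longrightarrow> \<xi>' = \<xi>"
      using bij_betw_ex1[OF b(2) deg[OF u]] by blast
    show "\<exists>!e. e \<in> E \<and> face X 1 0 e = u"
    proof (rule ex1I[of _ "long_edge X 2 \<xi>"])
      show "long_edge X 2 \<xi> \<in> E \<and> face X 1 0 (long_edge X 2 \<xi>) = u"
        using cl[OF \<xi>(1)] v_face(2) \<xi>(2) d_face[OF u] by simp
      fix e assume e: "e \<in> E \<and> face X 1 0 e = u"
      then have "degen X 1 1 e = \<xi>" using s(1)[of e 1] s_face(2)[of e] E1 by (intro uniq) auto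
      then show "e = long_edge X 2 \<xi>" using s(2)[of e 1] e by simp
    qed
  qed (rule face_in)
qed

lemma closings_bij:
  assumes X: "two_segal X" and E: "frobenius_set X E"
  shows "bij_betw (face X (n + 1) (n + 1)) (closings X E n) (ob X n)"
    and "bij_betw (face X (n + 1) 0) (closings X E n) (ob X n)"
proof -
  have S: "simplicial_set X" using X by (simp add: two_segal_def)
  consider "n = 0" | "n = 1" | "2 \<le> n" by linarith
  then have "bij_betw (face X (n + 1) (n + 1)) (closings X E n) (ob X n)
    \<and> bij_betw (face X (n + 1) 0) (closings X E n) (ob X n)"
  proof cases
    case 1
    then show ?thesis using closings_bij_0[OF S E] by simp
  next
    case 2
    then have "n + 1 = 2" by simp
    then show ?thesis using E unfolding 2 frobenius_set_def by (simp add: numeral_2_eq_2)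
  next
    case 3
    then show ?thesis using closings_bij_ge_2[OF X E] by blast
  qed
  then show "bij_betw (face X (n + 1) (n + 1)) (closings X E n) (ob X n)"
    and "bij_betw (face X (n + 1) 0) (closings X E n) (ob X n)" by blast+
qed

section \<open>Unrolling a simplex\<close>

text \<open>\<open>w k\<close> is the simplex on the window of vertices \<open>k, \<dots>, k + n + 1\<close>. Consecutive windows overlap in an
  \<open>n\<close>-simplex. The windows have this length because a morphism \<open>f : [m] \<rightarrow> [n]\<close> of the paracyclic category
  satisfies \<open>f m \<le> f 0 + n + 1\<close>, so that one of them contains \<open>f 0, \<dots>, f m\<close>.\<close>

definition unrolling :: "'a presheaf_data \<Rightarrow> 'a set \<Rightarrow> nat \<Rightarrow> (int \<Rightarrow> 'a) \<Rightarrow> bool" where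
  "unrolling X E n w \<longleftrightarrow>
     (\<forall>k. w k \<in> closings X E n \<and> face X (n + 1) 0 (w k) = face X (n + 1) (n + 1) (w (k + 1)))"

definition unroll :: "'a presheaf_data \<Rightarrow> 'a set \<Rightarrow> nat \<Rightarrow> 'a \<Rightarrow> int \<Rightarrow> 'a" where
  "unroll X E n x = (THE w. unrolling X E n w \<and> face X (n + 1) (n + 1) (w 0) = x)"

text \<open>The chain starts at the preimage of \<open>x\<close> under \<open>p\<close>; the inverse of \<open>p\<close> applied after \<open>q\<close> moves forwards,
  and the inverse of \<open>q\<close> applied after \<open>p\<close> moves backwards.\<close>

lemma ex1_bi_infinite_chain:
  assumes p: "bij_betw p F B" and q: "bij_betw q F B" and x: "x \<in> B"
  shows "\<exists>!w :: int \<Rightarrow> 'b. (\<forall>k. w k \<in> F \<and> q (w k) = p (w (k + 1))) \<and> p (w 0) = x"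
proof (rule ex_ex1I)
  define s where "s = (\<lambda>y. inv_into F p (q y))"
  define t where "t = (\<lambda>y. inv_into F q (p y))"
  define y where "y = inv_into F p x"
  have y: "y \<in> F" "p y = x"
    using p x unfolding y_def by (simp_all add: bij_betw_def inv_into_into f_inv_into_f)
  have s: "s z \<in> F" "p (s z) = q z" and t: "t z \<in> F" "q (t z) = p z" if "z \<in> F" for z
    using that p q bij_betwE[OF p] bij_betwE[OF q] unfolding s_def t_def
    by (simp_all add: bij_betw_def inv_into_into f_inv_into_f)
  have S: "(s ^^ k) y \<in> F" and T: "(t ^^ k) y \<in> F" for k
    by (induction k) (simp_all add: y s t)
  define w where "w = (\<lambda>k::int. if 0 \<le> k then (s ^^ nat k) y else (t ^^ nat (- k)) y)"
  have wF: "w k \<in> F" for k using S T by (simp add: w_def)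
  moreover have "q (w k) = p (w (k + 1))" for k
  proof (cases "0 \<le> k")
    case True
    then have "w (k + 1) = s (w k)" by (simp add: w_def nat_add_distrib)
    then show ?thesis using s(2)[OF wF] by simp
  next
    case False
    then have "nat (- k) = Suc (nat (- (k + 1)))" by simp
    then have "w k = t (w (k + 1))" using False by (cases "k = -1") (auto simp: w_def)
    then show ?thesis using t(2)[OF wF] by simp
  qed
  moreover have "p (w 0) = x" using y by (simp add: w_def)
  ultimately show "\<exists>w :: int \<Rightarrow> 'b. (\<forall>k. w k \<in> F \<and> q (w k) = p (w (k + 1))) \<and> p (w 0) = x" by blast
next
  fix w w' :: "int \<Rightarrow> 'b"
  assume w: "(\<forall>k. w k \<in> F \<and> q (w k) = p (w (k + 1))) \<and> p (w 0) = x"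
    and w': "(\<forall>k. w' k \<in> F \<and> q (w' k) = p (w' (k + 1))) \<and> p (w' 0) = x"
  have inj: "a = b" if "a \<in> F" "b \<in> F" "p a = p b \<or> q a = q b" for a b
    using that p q by (auto simp: bij_betw_def dest: inj_onD)
  have "w k = w' k" for k
  proof (induction k rule: int_induct[where k = 0])
    case base
    show ?case using w w' by (intro inj) auto
  next
    case (step1 i)
    have "p (w (i + 1)) = p (w' (i + 1))" using w w' step1(2) by metis
    then show ?case using w w' by (intro inj) auto
  next
    case (step2 i)
    have "q (w (i - 1)) = q (w' (i - 1))" using w w' step2(2) by (metis diff_add_cancel)
    then show ?case using w w' by (intro inj) auto
  qed
  then show "w = w'" ..
qed

lemma ex1_unrolling:
  assumes "two_segal X" "frobenius_set X E" "x \<in> ob X n"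
  shows "\<exists>!w. unrolling X E n w \<and> face X (n + 1) (n + 1) (w 0) = x"
  unfolding unrolling_def by (rule ex1_bi_infinite_chain[OF closings_bij[OF assms(1,2)] assms(3)])

lemma unrolling_unroll:
  assumes "two_segal X" "frobenius_set X E" "x \<in> ob X n"
  shows "unrolling X E n (unroll X E n x)" and "face X (n + 1) (n + 1) (unroll X E n x 0) = x"
  using theI'[OF ex1_unrolling[OF assms]] by (simp_all add: unroll_def)

lemma unroll_eqI:
  assumes "two_segal X" "frobenius_set X E" "x \<in> ob X n"
    and "unrolling X E n w" "face X (n + 1) (n + 1) (w 0) = x"
  shows "unroll X E n x = w"
  unfolding unroll_def by (rule the1_equality[OF ex1_unrolling[OF assms(1-3)]]) (use assms in blast)

definition window :: "'a presheaf_data \<Rightarrow> nat \<Rightarrow> (int \<Rightarrow> 'a) \<Rightarrow> nat \<Rightarrow> (int \<Rightarrow> int) \<Rightarrow> 'a" where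
  "window X n w m g = restrict_along X m (n + 1) (\<lambda>j. nat (g (int j) - g 0)) (w (g 0))"

lemma vertex_map_window:
  assumes "mono g" "a \<le> g 0" "g (int m) \<le> a + int N"
  shows "vertex_map m N (\<lambda>j. nat (g (int j) - a))"
proof -
  have "g (int i) \<le> g (int j)" if "i \<le> j" for i j using that assms(1) by (simp add: monoD)
  then show ?thesis
    using assms(3) unfolding vertex_map_def by (force intro: nat_mono simp: nat_le_iff)
qed

lemma unrolling_in:
  assumes "unrolling X E n w"
  shows "w k \<in> ob X (n + 1)"
  using assms by (simp add: unrolling_def closings_def)

text \<open>Any window that contains the values of \<open>g\<close> may be used for the restriction: move the window one
  step at a time towards the one starting at \<open>g 0\<close>; the values of \<open>g\<close> stay in the overlaps.\<close>

lemma window_independent: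
  assumes S: "simplicial_set X" and w: "unrolling X E n w" and g: "mono g"
    and le: "a \<le> g 0" "g (int m) \<le> a + int (n + 1)"
  shows "restrict_along X m (n + 1) (\<lambda>j. nat (g (int j) - a)) (w a) = window X n w m g"
  using le
proof (induction "nat (g 0 - a)" arbitrary: a)
  case 0
  then have "a = g 0" by simp
  then show ?case by (simp add: window_def)
next
  case (Suc d)
  have le: "a + 1 \<le> g 0" "g (int m) \<le> (a + 1) + int n" using Suc.hyps(2) Suc.prems by simp_all
  have gj: "a + 1 \<le> g (int j)" "j \<le> m \<Longrightarrow> g (int j) \<le> (a + 1) + int n" for j
    using le monoD[OF g, of 0 "int j"] monoD[OF g, of "int j" "int m"] by auto
  have Suc_nat: "Suc (nat (g (int j) - (a + 1))) = nat (g (int j) - a)" for j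
    using gj(1)[of j] by linarith
  let ?v = "\<lambda>j. nat (g (int j) - (a + 1))"
  have v: "vertex_map m n ?v" by (rule vertex_map_window[OF g le])
  have "restrict_along X m n ?v (face X (n + 1) 0 (w a))
      = restrict_along X m (n + 1) (\<lambda>j. nat (g (int j) - a)) (w a)"
    by (simp add: face_eq_restrict_along)
      (rule restrict_along_comp[OF S unrolling_in[OF w, simplified] v];
        use Suc_nat in \<open>auto simp: vertex_map_def\<close>)
  moreover have "restrict_along X m n ?v (face X (n + 1) (n + 1) (w (a + 1)))
      = restrict_along X m (n + 1) ?v (w (a + 1))"
    by (simp add: face_eq_restrict_along)
      (rule restrict_along_comp[OF S unrolling_in[OF w, simplified] v];
        use v in \<open>auto simp: vertex_map_def\<close>)
  moreover have "restrict_along X m (n + 1) ?v (w (a + 1)) = window X n w m g"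
    using Suc le by (intro Suc.hyps(1)) simp_all
  moreover have "face X (n + 1) 0 (w a) = face X (n + 1) (n + 1) (w (a + 1))"
    using w by (simp add: unrolling_def)
  ultimately show ?case by simp
qed

lemma window_in:
  assumes "simplicial_set X" "unrolling X E n w" "mono g" "g (int m) \<le> g 0 + int (n + 1)"
  shows "window X n w m g \<in> ob X m"
  unfolding window_def
  by (rule restrict_along_in[OF assms(1) vertex_map_window unrolling_in]) (use assms in auto)

lemma paracyclic_hom_last:
  assumes "f \<in> paracyclic_hom m n"
  shows "f (k + int m + 1) = f k + int n + 1" and "f (k + int m) \<le> f k + int (n + 1)"
proof -
  show *: "f (k + int m + 1) = f k + int n + 1"
    using paracyclic_homD(2)[OF assms, of k 1] by (simp add: add.assoc)
  show "f (k + int m) \<le> f k + int (n + 1)"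
    using paracyclic_homD(1)[OF assms, of "k + int m" "k + int m + 1"] * by simp
qed

text \<open>This is what makes the action functorial: restricting the windows along \<open>f\<close> is again an unrolling.
  The long edges are preserved because \<open>f\<close> commutes with the shift by one period.\<close>

lemma unrolling_pullback:
  assumes S: "simplicial_set X" and w: "unrolling X E n w" and f: "f \<in> paracyclic_hom m n"
  defines "w' \<equiv> \<lambda>k. window X n w (m + 1) (\<lambda>i. f (k + i))"
  shows "unrolling X E m w'" and "face X (m + 1) (m + 1) (w' 0) = window X n w m f"
proof -
  have mono: "mono (\<lambda>i. f (k + i))" for k
    using paracyclic_homD(1)[OF f] by (simp add: monoI)
  have last: "f (k + int (m + 1)) = f k + int (n + 1)" for k
    using paracyclic_hom_last(1)[OF f, of k] by (simp add: ac_simps)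
  have v: "vertex_map (m + 1) (n + 1) (\<lambda>j. nat (f (k + int j) - f k))" for k
    by (rule vertex_map_window[OF mono]) (simp_all only: last add_0_right order_refl)
  have w'_eq: "w' k = restrict_along X (m + 1) (n + 1) (\<lambda>j. nat (f (k + int j) - f k)) (w (f k))" for k
    by (simp add: w'_def window_def)
  note win = unrolling_in[OF w]
  have "w' k \<in> closings X E m" for k
  proof -
    have "long_edge X (m + 1) (w' k) = long_edge X (n + 1) (w (f k))"
      unfolding w'_eq
      by (rule restrict_along_comp[OF S win _ v])
        (use last[of k] in \<open>auto simp: vertex_map_def dest!: le_1_cases\<close>)
    moreover have "w' k \<in> ob X (m + 1)"
      unfolding w'_eq by (rule restrict_along_in[OF S v win])
    ultimately show ?thesis using w by (auto simp: closings_def unrolling_def)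
  qed
  moreover have last_face: "face X (m + 1) (m + 1) (w' k) = window X n w m (\<lambda>i. f (k + i))" for k
    unfolding w'_eq window_def
    by (simp add: face_eq_restrict_along)
      (rule restrict_along_comp[OF S win[simplified] _ v[simplified]]; auto simp: vertex_map_def)
  moreover have "face X (m + 1) 0 (w' k) = window X n w m (\<lambda>i. f (k + 1 + i))" for k
  proof -
    have "face X (m + 1) 0 (w' k)
        = restrict_along X m (n + 1) (\<lambda>j. nat (f (k + 1 + int j) - f k)) (w (f k))"
      unfolding w'_eq
      by (simp add: face_eq_restrict_along)
        (rule restrict_along_comp[OF S win[simplified] _ v[simplified]];
          auto simp: vertex_map_def algebra_simps)
    also have "\<dots> = window X n w m (\<lambda>i. f (k + 1 + i))"
    proof (rule window_independent[OF S w mono])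
      show "f k \<le> f (k + 1 + 0)" using paracyclic_homD(1)[OF f] by simp
      show "f (k + 1 + int m) \<le> f k + int (n + 1)"
        using last[of k] by (simp add: algebra_simps)
    qed
    finally show ?thesis .
  qed
  ultimately show "unrolling X E m w'" by (simp add: unrolling_def)
  show "face X (m + 1) (m + 1) (w' 0) = window X n w m f"
    using last_face[of 0] by simp
qed


section \<open>The paracyclic structure given by a Frobenius set\<close>

text \<open>Outside the morphisms and simplices the value is \<open>undefined\<close>, which \<open>paracyclic_structure\<close> demands.\<close>

definition paracyclic_extension :: "'a presheaf_data \<Rightarrow> 'a set \<Rightarrow> 'a presheaf_data" where
  "paracyclic_extension X E =
     \<lparr>ob = ob X,
      act = (\<lambda>m n f x. if f \<in> paracyclic_hom m n \<and> x \<in> ob X n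
                       then window X n (unroll X E n x) m f else undefined)\<rparr>"

text \<open>For morphisms of the simplex category the window starting at \<open>0\<close> can be used, so that the action is the
  given one. For composites, the unrolling of a restricted simplex is the restricted unrolling, and
  both sides become restrictions of one and the same window.\<close>

lemma paracyclic_structure_extension:
  assumes X: "two_segal X" and E: "frobenius_set X E"
  shows "paracyclic_structure X (paracyclic_extension X E)"
proof -
  let ?P = "paracyclic_extension X E"
  have S: "simplicial_set X" using X by (simp add: two_segal_def)
  have ob: "ob ?P = ob X" by (simp add: paracyclic_extension_def)
  have act: "act ?P m n f x = window X n (unroll X E n x) m f"
    if "f \<in> paracyclic_hom m n" "x \<in> ob X n" for m n f x
    using that by (simp add: paracyclic_extension_def)
  note unr = unrolling_unroll[OF X E]
  have mono: "mono f" if "f \<in> paracyclic_hom m n" for f m n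
    using that by (simp add: paracyclic_hom_def)
  have into: "act ?P m n f x \<in> ob X m" if f: "f \<in> paracyclic_hom m n" and x: "x \<in> ob X n" for m n f x
    unfolding act[OF that]
    by (rule window_in[OF S unr(1)[OF x] mono[OF f]]) (use paracyclic_hom_last(2)[OF f, of 0] in simp)
  have simplex: "act ?P m n f x = act X m n f x"
    if f: "f \<in> simplex_hom m n" and x: "x \<in> ob X n" for m n f x
  proof -
    have fp: "f \<in> paracyclic_hom m n" and im: "f ` {0..int m} \<subseteq> {0..int n}"
      using f by (auto simp: simplex_hom_def)
    have f0: "f 0 \<in> {0..int n}" and fm: "f (int m) \<in> {0..int n}"
      by (rule subsetD[OF im imageI], simp)+
    let ?w = "unroll X E n x"
    have "act ?P m n f x = restrict_along X m (n + 1) (\<lambda>j. nat (f (int j) - 0)) (?w 0)"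
      unfolding act[OF fp x]
      by (rule window_independent[OF S unr(1)[OF x] mono[OF fp], symmetric]) (use f0 fm in auto)
    also have "\<dots> = restrict_along X m n (\<lambda>j. nat (f (int j))) (face X (n + 1) (n + 1) (?w 0))"
      by (simp add: face_eq_restrict_along)
        (rule restrict_along_comp[OF S unrolling_in[OF unr(1)[OF x], simplified]
            simplex_hom_periodic(1)[OF f], symmetric];
          use simplex_hom_periodic(1)[OF f] in \<open>auto simp: vertex_map_def\<close>)
    also have "\<dots> = act X m n f x"
      unfolding unr(2)[OF x] act_eq_restrict_along[OF f] ..
    finally show ?thesis .
  qed
  have "act ?P n n id x = x" if x: "x \<in> ob X n" for n x
  proof -
    have "id \<in> simplex_hom n n" by (simp add: simplex_hom_def paracyclic_hom_def mono_def)
    then show ?thesis using simplex S x by (simp add: simplicial_set_def presheaf_def)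
  qed
  moreover have "act ?P m p (g \<circ> f) x = act ?P m n f (act ?P n p g x)"
    if f: "f \<in> paracyclic_hom m n" and g: "g \<in> paracyclic_hom n p" and x: "x \<in> ob X p" for m n p f g x
  proof -
    let ?w = "unroll X E p x" and ?z = "act ?P n p g x"
    define w' where "w' = (\<lambda>k. window X p ?w (n + 1) (\<lambda>i. g (k + i)))"
    note w = unr(1)[OF x]
    have z: "?z \<in> ob X n" by (rule into[OF g x])
    have "unroll X E n ?z = w'"
      unfolding w'_def using unrolling_pullback[OF S w g]
      by (intro unroll_eqI[OF X E z]) (simp_all add: act[OF g x])
    then have "act ?P m n f ?z = window X n w' m f" by (simp add: act[OF f z])
    also have "\<dots> = restrict_along X m (p + 1) (\<lambda>j. nat (g (f (int j)) - g (f 0))) (?w (g (f 0)))"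
      unfolding window_def w'_def
    proof (simp only: add_0_right, rule restrict_along_comp[OF S unrolling_in[OF w]])
      show "vertex_map m (n + 1) (\<lambda>j. nat (f (int j) - f 0))"
        by (rule vertex_map_window[OF mono[OF f]]) (use paracyclic_hom_last(2)[OF f, of 0] in simp_all)
      have "g (f 0 + int (n + 1)) = g (f 0) + int (p + 1)"
        using paracyclic_hom_last(1)[OF g, of "f 0"] by (simp add: ac_simps)
      then show "vertex_map (n + 1) (p + 1) (\<lambda>j. nat (g (f 0 + int j) - g (f 0)))"
        using vertex_map_window[of "\<lambda>i. g (f 0 + i)" "g (f 0)" "n + 1" "p + 1"] paracyclic_homD(1)[OF g]
        by (simp add: monoI)
      show "nat (g (f 0 + int (nat (f (int j) - f 0))) - g (f 0)) = nat (g (f (int j)) - g (f 0))" for j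
        using paracyclic_homD(1)[OF f, of 0 "int j"] by simp
    qed
    also have "\<dots> = act ?P m p (g \<circ> f) x"
      unfolding act[OF paracyclic_hom_comp[OF f g] x] by (simp add: window_def)
    finally show ?thesis ..
  qed
  ultimately have "paracyclic_set ?P"
    unfolding paracyclic_set_def presheaf_def ob using into by blast
  then show ?thesis
    unfolding paracyclic_structure_def using ob simplex by (auto simp: paracyclic_extension_def)
qed

text \<open>The morphism \<open>[n + 1] \<rightarrow> [n]\<close> with \<open>i \<mapsto> i\<close> for \<open>0 \<le> i \<le> n + 1\<close>. It is not in the simplex category:
  it acts as the degeneracy \<open>s\<^sub>0\<close> followed by a rotation, and closes an \<open>n\<close>-simplex up.\<close>

definition closing_map :: "nat \<Rightarrow> int \<Rightarrow> int" where
  "closing_map n = periodic (n + 1) n id"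

definition frobenius_set_of :: "'a presheaf_data \<Rightarrow> 'a set" where
  "frobenius_set_of P = act P 1 0 (closing_map 0) ` ob P 0"

lemma closing_map_hom: "closing_map n \<in> paracyclic_hom (n + 1) n"
  unfolding closing_map_def by (rule periodic_paracyclic_hom) auto

lemma closing_map_of_nat: "j \<le> n + 1 \<Longrightarrow> closing_map n (int j) = int j"
  unfolding closing_map_def by (simp add: periodic_of_nat)

lemma frobenius_set_of_extension:
  assumes X: "two_segal X" and E: "frobenius_set X E"
  shows "frobenius_set_of (paracyclic_extension X E) = E"
proof -
  have S: "simplicial_set X" using X by (simp add: two_segal_def)
  have E1: "E \<subseteq> ob X 1" using E by (simp add: frobenius_set_def)
  note unr = unrolling_unroll[OF X E]
  have act: "act (paracyclic_extension X E) 1 0 (closing_map 0) x = unroll X E 0 x 0" if x: "x \<in> ob X 0" for x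
  proof -
    have "act (paracyclic_extension X E) 1 0 (closing_map 0) x
        = window X 0 (unroll X E 0 x) 1 (closing_map 0)"
      using x closing_map_hom[of 0] by (simp add: paracyclic_extension_def)
    also have "\<dots> = unroll X E 0 x 0"
      using closing_map_of_nat[of _ 0] closing_map_of_nat[of 0 0] unrolling_in[OF unr(1)[OF x], of 0]
      unfolding window_def by (simp, intro restrict_along_id[OF S]) simp_all
    finally show ?thesis .
  qed
  have c0: "closings X E 0 = E" by (rule closings_0[OF S E1])
  have "unroll X E 0 x 0 \<in> E" if "x \<in> ob X 0" for x
    using unr(1)[OF that] c0 unfolding unrolling_def by blast
  moreover have "\<exists>x\<in>ob X 0. e = unroll X E 0 x 0" if e: "e \<in> E" for e
  proof
    have b: "bij_betw (face X 1 1) E (ob X 0)" using closings_bij_0(1)[OF S E] c0 by simp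
    show x: "face X 1 1 e \<in> ob X 0" using bij_betwE[OF b] e by blast
    show "e = unroll X E 0 (face X 1 1 e) 0"
      by (rule inj_onD[OF bij_betw_imp_inj_on[OF b]])
        (use unr(1)[OF x] unr(2)[OF x] c0 e in \<open>auto simp: unrolling_def\<close>)
  qed
  ultimately show ?thesis
    unfolding frobenius_set_of_def using act by (auto simp: image_iff paracyclic_extension_def)
qed

section \<open>The Frobenius set of a paracyclic structure\<close>

lemma paracyclic_structureD:
  assumes "paracyclic_structure X P"
  shows act_in: "f \<in> paracyclic_hom m n \<Longrightarrow> x \<in> ob X n \<Longrightarrow> act P m n f x \<in> ob X m"
    and act_act: "f \<in> paracyclic_hom m n \<Longrightarrow> g \<in> paracyclic_hom n p \<Longrightarrow> x \<in> ob X p \<Longrightarrow>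
      act P m n f (act P n p g x) = act P m p (g \<circ> f) x"
    and act_id: "x \<in> ob X n \<Longrightarrow> act P n n id x = x"
    and restrict_along_eq_act: "vertex_map m n v \<Longrightarrow> x \<in> ob X n \<Longrightarrow>
      restrict_along X m n v x = act P m n (periodic m n v) x"
    and ob_eq: "ob P = ob X"
    and act_undefined: "f \<notin> paracyclic_hom m n \<or> x \<notin> ob P n \<Longrightarrow> act P m n f x = undefined"
proof -
  have P: "presheaf paracyclic_hom P" and ob: "ob P = ob X"
    and eq: "\<forall>m n. \<forall>f\<in>simplex_hom m n. \<forall>x\<in>ob X n. act P m n f x = act X m n f x"
    and und: "\<forall>m n f x. f \<notin> paracyclic_hom m n \<or> x \<notin> ob P n \<longrightarrow> act P m n f x = undefined"
    using assms by (auto simp: paracyclic_structure_def paracyclic_set_def)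
  show "ob P = ob X" by (rule ob)
  show "act P m n f x = undefined" if "f \<notin> paracyclic_hom m n \<or> x \<notin> ob P n"
    using und that by blast
  show "act P m n f x \<in> ob X m" if "f \<in> paracyclic_hom m n" "x \<in> ob X n"
    using P that unfolding presheaf_def ob by blast
  show "act P m n f (act P n p g x) = act P m p (g \<circ> f) x"
    if "f \<in> paracyclic_hom m n" "g \<in> paracyclic_hom n p" "x \<in> ob X p"
    using P that unfolding presheaf_def ob by simp
  show "act P n n id x = x" if "x \<in> ob X n"
    using P that unfolding presheaf_def ob by blast
  show "restrict_along X m n v x = act P m n (periodic m n v) x" if "vertex_map m n v" "x \<in> ob X n"
    using eq periodic_simplex_hom[OF that(1)] that(2) by (simp add: restrict_along_def)
qed

lemma restrict_along_act:
  assumes P: "paracyclic_structure X P" and v: "vertex_map l m v"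
    and g: "g \<in> paracyclic_hom m n" and x: "x \<in> ob X n" and h: "h \<in> paracyclic_hom l n"
    and eq: "\<And>j. j \<le> l \<Longrightarrow> g (int (v j)) = h (int j)"
  shows "restrict_along X l m v (act P m n g x) = act P l n h x"
proof -
  have vp: "periodic l m v \<in> paracyclic_hom l m"
    using periodic_simplex_hom[OF v] by (simp add: simplex_hom_def)
  have "g \<circ> periodic l m v = h"
    by (rule paracyclic_hom_eqI[OF paracyclic_hom_comp[OF vp g] h]) (simp add: periodic_of_nat eq)
  then show ?thesis
    using act_act[OF P vp g x] restrict_along_eq_act[OF P v act_in[OF P g x]] by simp
qed

lemma shift_hom: "(\<lambda>i. i + k) \<in> paracyclic_hom n n"
  by (simp add: paracyclic_hom_def mono_def)

lemma closing_map_closes: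
  assumes P: "paracyclic_structure X P" and x: "x \<in> ob X n"
  defines "\<psi> \<equiv> act P (n + 1) n (closing_map n) x"
  shows "\<psi> \<in> closings X (frobenius_set_of P) n"
    and "face X (n + 1) (n + 1) \<psi> = x"
    and "face X (n + 1) 0 \<psi> = act P n n (\<lambda>i. i + 1) x"
proof -
  have vert: "(\<lambda>i. i * (int n + 1)) \<in> paracyclic_hom 0 n"
    by (simp add: paracyclic_hom_def mono_def mult_right_mono distrib_right)
  have c0: "closing_map 0 \<in> paracyclic_hom 1 0" using closing_map_hom[of 0] by simp
  have "long_edge X (n + 1) \<psi> = act P 1 n ((\<lambda>i. i * (int n + 1)) \<circ> closing_map 0) x"
    unfolding \<psi>_def
  proof (rule restrict_along_act[OF P _ closing_map_hom x paracyclic_hom_comp[OF c0 vert]])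
    show "closing_map n (int (j * (n + 1))) = ((\<lambda>i. i * (int n + 1)) \<circ> closing_map 0) (int j)"
      if "j \<le> 1" for j
      using that closing_map_of_nat[of "j * (n + 1)" n] closing_map_of_nat[of j 0]
      by (auto simp: algebra_simps dest!: le_1_cases)
  qed (auto simp: vertex_map_def dest!: le_1_cases)
  also have "\<dots> = act P 1 0 (closing_map 0) (act P 0 n (\<lambda>i. i * (int n + 1)) x)"
    by (rule act_act[OF P c0 vert x, symmetric])
  also have "\<dots> \<in> frobenius_set_of P"
    unfolding frobenius_set_of_def ob_eq[OF P] using act_in[OF P vert x] by blast
  finally show "\<psi> \<in> closings X (frobenius_set_of P) n"
    using act_in[OF P closing_map_hom x] by (simp add: closings_def \<psi>_def)
  have "face X (n + 1) (n + 1) \<psi> = act P n n id x"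
    unfolding face_eq_restrict_along \<psi>_def diff_add_inverse2
    by (rule restrict_along_act[OF P _ closing_map_hom x])
      (auto simp: vertex_map_def paracyclic_hom_def mono_def closing_map_of_nat)
  then show "face X (n + 1) (n + 1) \<psi> = x" using act_id[OF P x] by simp
  show "face X (n + 1) 0 \<psi> = act P n n (\<lambda>i. i + 1) x"
    unfolding face_eq_restrict_along \<psi>_def diff_add_inverse2
  proof (rule restrict_along_act[OF P _ closing_map_hom x shift_hom])
    show "closing_map n (int (if j < 0 then j else j + 1)) = int j + 1" if "j \<le> n" for j
      using that closing_map_of_nat[of "j + 1" n] by simp
  qed (auto simp: vertex_map_def)
qed

text \<open>The simplex closing \<open>d\<^sub>2 \<xi>\<close> is unique: let \<open>\<xi>'\<close> be \<open>\<xi>\<close> rotated backwards by one step, so that its first edge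
  is the long edge of \<open>\<xi>\<close> rotated backwards. As the latter edge lies in the Frobenius set, its rotation is
  degenerate. By unitality \<open>\<xi>'\<close> is the degeneracy \<open>s\<^sub>0\<close> of its edge \<open>d\<^sub>0 \<xi>' = d\<^sub>2 \<xi>\<close>, and rotating forwards
  again shows that \<open>\<xi>\<close> is determined by \<open>d\<^sub>2 \<xi>\<close>.\<close>

lemma closings_frobenius_set_of:
  assumes X: "two_segal X" and P: "paracyclic_structure X P"
    and \<xi>: "\<xi> \<in> closings X (frobenius_set_of P) 1"
  shows "act P 2 1 (closing_map 1) (face X 2 2 \<xi>) = \<xi>"
proof -
  have S: "simplicial_set X" using X by (simp add: two_segal_def)
  have \<xi>2: "\<xi> \<in> ob X 2" and "long_edge X 2 \<xi> \<in> frobenius_set_of P"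
    using \<xi> by (auto simp: closings_def numeral_2_eq_2)
  then obtain u where u: "u \<in> ob X 0" "long_edge X 2 \<xi> = act P 1 0 (closing_map 0) u"
    by (auto simp: frobenius_set_of_def ob_eq[OF P])
  have c0: "closing_map 0 \<in> paracyclic_hom 1 0" and c1: "closing_map 1 \<in> paracyclic_hom 2 1"
    using closing_map_hom[of 0] closing_map_hom[of 1] by (simp_all add: numeral_2_eq_2)
  have unshift: "(\<lambda>i. i - 1) \<in> paracyclic_hom n n" for n using shift_hom[of "-1"] by simp
  define \<xi>' where "\<xi>' = act P 2 2 (\<lambda>i. i - 1) \<xi>"
  have \<xi>'2: "\<xi>' \<in> ob X 2" unfolding \<xi>'_def by (rule act_in[OF P unshift \<xi>2])
  have v: "vertex_map 1 2 (\<lambda>j. j * 2)" "vertex_map 1 0 (\<lambda>j. 0)" "vertex_map 2 1 (\<lambda>j. j - 1)"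
    by (auto simp: vertex_map_def)
  have vp: "periodic 1 2 (\<lambda>j. j * 2) \<in> paracyclic_hom 1 2"
    "periodic 1 0 (\<lambda>j. 0) \<in> paracyclic_hom 1 0" "periodic 2 1 (\<lambda>j. j - 1) \<in> paracyclic_hom 2 1"
    using v[THEN periodic_simplex_hom] by (auto simp: simplex_hom_def)
  have "face X 2 2 \<xi>' = act P 1 2 (periodic 1 2 (\<lambda>j. j * 2) \<circ> (\<lambda>i. i - 1)) \<xi>"
    unfolding face_eq_restrict_along \<xi>'_def
    by (simp, rule restrict_along_act[OF P _ unshift \<xi>2 paracyclic_hom_comp[OF unshift vp(1), simplified]])
      (auto simp: vertex_map_def periodic_def dest!: le_1_cases)
  also have "\<dots> = act P 1 1 (\<lambda>i. i - 1) (long_edge X 2 \<xi>)"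
    unfolding restrict_along_eq_act[OF P v(1) \<xi>2] by (rule act_act[OF P unshift vp(1) \<xi>2, symmetric])
  also have "\<dots> = act P 1 0 (closing_map 0 \<circ> (\<lambda>i. i - 1)) u"
    unfolding u(2) by (rule act_act[OF P unshift c0 u(1)])
  also have "closing_map 0 \<circ> (\<lambda>i. i - 1) = periodic 1 0 (\<lambda>j. 0)"
    by (rule paracyclic_hom_eqI[OF paracyclic_hom_comp[OF unshift c0] vp(2)])
      (auto simp: closing_map_def periodic_def dest!: le_1_cases)
  also have "act P 1 0 (periodic 1 0 (\<lambda>j. 0)) u = degen X 0 0 u"
    unfolding restrict_along_eq_act[OF P v(2) u(1), symmetric] degen_eq_restrict_along
    by (simp, rule restrict_along_cong) (auto dest!: le_1_cases)
  finally have "\<xi>' = degen X 1 0 (face X 2 0 \<xi>')"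
    using degenerate_of_first_edge[OF X \<xi>'2 u(1)] by simp
  also have "face X 2 0 \<xi>' = face X 2 2 \<xi>"
  proof -
    have v2: "vertex_map 1 2 (\<lambda>j. if j < 2 then j else j + 1)" by (auto simp: vertex_map_def)
    have vp2: "periodic 1 2 (\<lambda>j. if j < 2 then j else j + 1) \<in> paracyclic_hom 1 2"
      using v2[THEN periodic_simplex_hom] by (auto simp: simplex_hom_def)
    have "face X 2 0 \<xi>' = act P 1 2 (periodic 1 2 (\<lambda>j. if j < 2 then j else j + 1)) \<xi>"
      unfolding face_eq_restrict_along \<xi>'_def
      by (simp, rule restrict_along_act[OF P _ unshift \<xi>2 vp2[simplified]])
        (auto simp: vertex_map_def periodic_def dest!: le_1_cases)
    also have "\<dots> = face X 2 2 \<xi>"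
      unfolding face_eq_restrict_along using restrict_along_eq_act[OF P v2 \<xi>2] by simp
    finally show ?thesis .
  qed
  also have "degen X 1 0 (face X 2 2 \<xi>) = act P 2 1 (periodic 2 1 (\<lambda>j. j - 1)) (face X 2 2 \<xi>)"
  proof -
    have "degen X 1 0 (face X 2 2 \<xi>) = restrict_along X 2 1 (\<lambda>j. j - 1) (face X 2 2 \<xi>)"
      unfolding degen_eq_restrict_along
      by (simp add: numeral_2_eq_2[symmetric], rule restrict_along_cong) auto
    then show ?thesis
      using restrict_along_eq_act[OF P v(3)] end_faces_in(2)[OF S, of \<xi> 1] \<xi>2
      by (simp add: numeral_2_eq_2)
  qed
  finally have \<xi>': "\<xi>' = act P 2 1 (periodic 2 1 (\<lambda>j. j - 1)) (face X 2 2 \<xi>)" .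
  have y: "face X 2 2 \<xi> \<in> ob X 1"
    using end_faces_in(2)[OF S, of \<xi> 1] \<xi>2 by (simp add: numeral_2_eq_2)
  have "\<xi> = act P 2 2 (\<lambda>i. i + 1) \<xi>'"
    unfolding \<xi>'_def act_act[OF P shift_hom unshift \<xi>2] using act_id[OF P \<xi>2]
    by (simp add: comp_def id_def)
  also have "\<dots> = act P 2 1 (periodic 2 1 (\<lambda>j. j - 1) \<circ> (\<lambda>i. i + 1)) (face X 2 2 \<xi>)"
    unfolding \<xi>' by (rule act_act[OF P shift_hom vp(3) y])
  also have "periodic 2 1 (\<lambda>j. j - 1) \<circ> (\<lambda>i. i + 1) = closing_map 1"
    by (rule paracyclic_hom_eqI[OF paracyclic_hom_comp[OF shift_hom vp(3)] c1])
      (auto simp: closing_map_def periodic_def dest!: le_2_cases)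
  finally show ?thesis ..
qed

text \<open>On the closings, \<open>d\<^sub>2\<close> is inverse to the action of the closing map, and \<open>d\<^sub>0\<close> is \<open>d\<^sub>2\<close> followed by the
  rotation, which is bijective.\<close>

lemma frobenius_set_frobenius_set_of:
  assumes X: "two_segal X" and P: "paracyclic_structure X P"
  shows "frobenius_set X (frobenius_set_of P)"
proof -
  let ?E = "frobenius_set_of P" and ?c = "act P 2 1 (closing_map 1)"
  have S: "simplicial_set X" using X by (simp add: two_segal_def)
  note closes = closing_map_closes[OF P, of _ 1, unfolded one_add_one]
  note closed = closings_frobenius_set_of[OF X P]
  have "?E \<subseteq> ob X 1"
    using act_in[OF P closing_map_hom[of 0]] by (auto simp: frobenius_set_of_def ob_eq[OF P])
  moreover have b2: "bij_betw (face X 2 2) (closings X ?E 1) (ob X 1)"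
  proof (rule bij_betw_byWitness[where f' = ?c])
    show "face X 2 2 ` closings X ?E 1 \<subseteq> ob X 1"
      using end_faces_in(2)[OF S, of _ 1] by (auto simp: closings_def numeral_2_eq_2)
  qed (use closes closed in auto)
  moreover have "bij_betw (face X 2 0) (closings X ?E 1) (ob X 1)"
  proof -
    have "bij_betw (act P 1 1 (\<lambda>i. i + 1)) (ob X 1) (ob X 1)"
    proof (rule bij_betw_byWitness[where f' = "act P 1 1 (\<lambda>i. i + (-1))"])
      show "\<forall>x\<in>ob X 1. act P 1 1 (\<lambda>i. i + (-1)) (act P 1 1 (\<lambda>i. i + 1) x) = x"
        "\<forall>x\<in>ob X 1. act P 1 1 (\<lambda>i. i + 1) (act P 1 1 (\<lambda>i. i + (-1)) x) = x"
        using act_id[OF P, of _ 1] act_act[OF P shift_hom shift_hom, of _ 1]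
        by (simp_all add: comp_def id_def del: add_uminus_conv_diff)
    qed (use act_in[OF P shift_hom] in blast)+
    from bij_betw_trans[OF b2 this]
    have "bij_betw (act P 1 1 (\<lambda>i. i + 1) \<circ> face X 2 2) (closings X ?E 1) (ob X 1)" .
    moreover have "(act P 1 1 (\<lambda>i. i + 1) \<circ> face X 2 2) \<xi> = face X 2 0 \<xi>" if "\<xi> \<in> closings X ?E 1" for \<xi>
      using closes(3)[of "face X 2 2 \<xi>"] closed[OF that] bij_betwE[OF b2] that by simp
    ultimately show ?thesis using bij_betw_cong by blast
  qed
  ultimately show ?thesis by (simp add: frobenius_set_def)
qed

text \<open>In a paracyclic set the windows of \<open>x\<close> are obtained by closing the rotations of \<open>x\<close>, so its action
  is recovered from its Frobenius set.\<close>

lemma paracyclic_extension_frobenius_set_of: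
  assumes X: "two_segal X" and P: "paracyclic_structure X P"
  shows "paracyclic_extension X (frobenius_set_of P) = P"
proof -
  let ?E = "frobenius_set_of P"
  have E: "frobenius_set X ?E" by (rule frobenius_set_frobenius_set_of[OF assms])
  have act: "window X n (unroll X ?E n x) m f = act P m n f x"
    if f: "f \<in> paracyclic_hom m n" and x: "x \<in> ob X n" for m n f x
  proof -
    define w where "w = (\<lambda>k. act P (n + 1) n (closing_map n) (act P n n (\<lambda>i. i + k) x))"
    have "unroll X ?E n x = w"
    proof (rule unroll_eqI[OF X E x])
      have sh: "act P n n (\<lambda>i. i + 1) (act P n n (\<lambda>i. i + k) x) = act P n n (\<lambda>i. i + (k + 1)) x" for k
        using act_act[OF P shift_hom shift_hom x, of 1 k] by (simp add: comp_def ac_simps)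
      show "unrolling X ?E n w"
        using closing_map_closes[OF P act_in[OF P shift_hom x]]
        by (simp add: unrolling_def w_def sh del: One_nat_def add_Suc_right)
      show "face X (n + 1) (n + 1) (w 0) = x"
        unfolding w_def closing_map_closes(2)[OF P act_in[OF P shift_hom x]]
        using act_id[OF P x] by (simp add: id_def)
    qed
    moreover have "w k = act P (n + 1) n ((\<lambda>i. i + k) \<circ> closing_map n) x" for k
      unfolding w_def by (rule act_act[OF P closing_map_hom shift_hom x])
    moreover have "restrict_along X m (n + 1) (\<lambda>j. nat (f (int j) - f 0))
        (act P (n + 1) n ((\<lambda>i. i + f 0) \<circ> closing_map n) x) = act P m n f x"
    proof (rule restrict_along_act[OF P _ paracyclic_hom_comp[OF closing_map_hom shift_hom] x f])
      show v: "vertex_map m (n + 1) (\<lambda>j. nat (f (int j) - f 0))"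
        by (rule vertex_map_window)
          (use f paracyclic_hom_last(2)[OF f, of 0] in \<open>simp_all add: paracyclic_hom_def\<close>)
      show "((\<lambda>i. i + f 0) \<circ> closing_map n) (int (nat (f (int j) - f 0))) = f (int j)" if "j \<le> m" for j
      proof -
        have "nat (f (int j) - f 0) \<le> n + 1" using v that unfolding vertex_map_def by blast
        from closing_map_of_nat[OF this] show ?thesis using paracyclic_homD(1)[OF f, of 0 "int j"] by simp
      qed
    qed
    ultimately show ?thesis by (simp add: window_def)
  qed
  have "act (paracyclic_extension X ?E) = act P"
    using act act_undefined[OF P] ob_eq[OF P]
    by (auto simp: paracyclic_extension_def fun_eq_iff)
  then show ?thesis
    using ob_eq[OF P] by (intro presheaf_data.equality) (simp_all add: paracyclic_extension_def)
qed

section \<open>Biexact pairings of spans\<close>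

lemma invertible_2mor_id_spanD:
  assumes "invertible_2mor f (id_span M) h"
  shows "bij_betw (lleg f) (apex f) M" and "\<And>s. s \<in> apex f \<Longrightarrow> rleg f s = lleg f s"
proof -
  have "h \<in> apex f \<rightarrow> M" and legs: "\<forall>s\<in>apex f. h s = lleg f s \<and> h s = rleg f s"
    using assms by (auto simp: invertible_2mor_def span_2mor_def id_span_def)
  then have h: "h s = lleg f s" "h s = rleg f s" "h s \<in> M" if "s \<in> apex f" for s
    using that by blast+
  then show "rleg f s = lleg f s" if "s \<in> apex f" for s using that by metis
  obtain k where k: "k \<in> M \<rightarrow> apex f" "\<forall>s\<in>apex f. k (h s) = s" "\<forall>x\<in>M. h (k x) = x"
    using assms by (auto simp: invertible_2mor_def span_2mor_def id_span_def)
  show "bij_betw (lleg f) (apex f) M"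
    by (rule bij_betw_byWitness[where f' = k]) (use h k in \<open>auto simp: Pi_iff h(1)[symmetric]\<close>)
qed

lemma invertible_2mor_id_spanI:
  assumes bij: "bij_betw (lleg f) (apex f) M" and eq: "\<And>s. s \<in> apex f \<Longrightarrow> rleg f s = lleg f s"
  shows "invertible_2mor f (id_span M) (lleg f)"
proof -
  have k: "inv_into (apex f) (lleg f) x \<in> apex f" "lleg f (inv_into (apex f) (lleg f) x) = x" if "x \<in> M" for x
    using bij that by (auto simp: bij_betw_def inv_into_into f_inv_into_f)
  show ?thesis
    unfolding invertible_2mor_def
  proof (intro conjI exI[of _ "inv_into (apex f) (lleg f)"] ballI)
    show "span_2mor f (id_span M) (lleg f)"
      using bij_betwE[OF bij] eq by (simp add: span_2mor_def id_span_def)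
    show "span_2mor (id_span M) f (inv_into (apex f) (lleg f))"
      using k eq by (simp add: span_2mor_def id_span_def)
    show "inv_into (apex f) (lleg f) (lleg f s) = s" if "s \<in> apex f" for s
      using bij_betw_inv_into_left[OF bij that] .
  qed (use k in \<open>simp add: id_span_def\<close>)
qed

lemma mem_apex_z_source:
  "((b, w), (x, a)) \<in> apex (z_source M \<alpha> \<beta>) \<longleftrightarrow>
     b \<in> apex \<beta> \<and> w \<in> M \<and> x \<in> M \<and> a \<in> apex \<alpha> \<and>
     x = fst (rleg \<beta> b) \<and> lleg \<alpha> a = (snd (rleg \<beta> b), w)"
  by (auto simp: z_source_def refoot_def span_comp_def span_prod_def id_span_def split: prod.splits)

lemma mem_apex_n_source:
  "((x, b), (a, w)) \<in> apex (n_source M \<alpha> \<beta>) \<longleftrightarrow>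
     b \<in> apex \<beta> \<and> w \<in> M \<and> x \<in> M \<and> a \<in> apex \<alpha> \<and>
     w = snd (rleg \<beta> b) \<and> lleg \<alpha> a = (x, fst (rleg \<beta> b))"
  by (auto simp: n_source_def refoot_def span_comp_def span_prod_def id_span_def split: prod.splits)

lemma legs_z_source:
  "lleg (z_source M \<alpha> \<beta>) ((b, w), (x, a)) = w" "rleg (z_source M \<alpha> \<beta>) ((b, w), (x, a)) = x"
  by (simp_all add: z_source_def refoot_def span_comp_def span_prod_def id_span_def)

lemma legs_n_source:
  "lleg (n_source M \<alpha> \<beta>) ((x, b), (a, w)) = x" "rleg (n_source M \<alpha> \<beta>) ((x, b), (a, w)) = w"
  by (simp_all add: n_source_def refoot_def span_comp_def span_prod_def id_span_def)

text \<open>Write \<open>(p, q)\<close> for the legs of \<open>\<alpha>\<close> and \<open>(r, s)\<close> for those of \<open>\<beta>\<close>. The composite in \<open>z\<close> consists of the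
  pairs \<open>(b, a)\<close> with \<open>s b = p a\<close>, and being isomorphic to the identity span it forces \<open>r b = q a\<close> and makes
  \<open>(b, a) \<mapsto> q a\<close> bijective. The composite in \<open>n\<close> consists of the pairs with \<open>r b = q a\<close>; it forces
  \<open>s b = p a\<close> and makes \<open>(b, a) \<mapsto> p a\<close> bijective. So the two sets of pairs agree, which yields that \<open>p\<close> and
  \<open>q\<close> are bijective.\<close>

lemma biexact_witness_imp_legs_bij:
  assumes wit: "biexact_witness M \<alpha> \<beta> z n" and \<alpha>: "lleg \<alpha> \<in> apex \<alpha> \<rightarrow> M \<times> M"
  shows "bij_betw (\<lambda>a. fst (lleg \<alpha> a)) (apex \<alpha>) M" and "bij_betw (\<lambda>a. snd (lleg \<alpha> a)) (apex \<alpha>) M"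
proof -
  define p q r s where "p = (\<lambda>a. fst (lleg \<alpha> a))" and "q = (\<lambda>a. snd (lleg \<alpha> a))"
    and "r = (\<lambda>b. fst (rleg \<beta> b))" and "s = (\<lambda>b. snd (rleg \<beta> b))"
  have pq: "lleg \<alpha> a = (p a, q a)" "a \<in> apex \<alpha> \<Longrightarrow> p a \<in> M" "a \<in> apex \<alpha> \<Longrightarrow> q a \<in> M" for a
    using \<alpha> by (force simp: p_def q_def Pi_iff)+
  have rs: "b \<in> apex \<beta> \<Longrightarrow> r b \<in> M" "b \<in> apex \<beta> \<Longrightarrow> s b \<in> M" for b
    using wit by (force simp: biexact_witness_def is_span_def r_def s_def Pi_iff)+
  have z: "bij_betw (lleg (z_source M \<alpha> \<beta>)) (apex (z_source M \<alpha> \<beta>)) M"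
    "\<And>t. t \<in> apex (z_source M \<alpha> \<beta>) \<Longrightarrow> rleg (z_source M \<alpha> \<beta>) t = lleg (z_source M \<alpha> \<beta>) t"
    and n: "bij_betw (lleg (n_source M \<alpha> \<beta>)) (apex (n_source M \<alpha> \<beta>)) M"
    "\<And>t. t \<in> apex (n_source M \<alpha> \<beta>) \<Longrightarrow> rleg (n_source M \<alpha> \<beta>) t = lleg (n_source M \<alpha> \<beta>) t"
    using wit invertible_2mor_id_spanD unfolding biexact_witness_def by metis+
  have zt: "((b, q a), (r b, a)) \<in> apex (z_source M \<alpha> \<beta>)"
    if "b \<in> apex \<beta>" "a \<in> apex \<alpha>" "s b = p a" for a b
    using that pq rs by (simp add: mem_apex_z_source r_def s_def)
  have nt: "((p a, b), (a, s b)) \<in> apex (n_source M \<alpha> \<beta>)"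
    if "b \<in> apex \<beta>" "a \<in> apex \<alpha>" "r b = q a" for a b
    using that pq rs by (simp add: mem_apex_n_source r_def s_def)
  have composable: "s b = p a \<longleftrightarrow> r b = q a" if "b \<in> apex \<beta>" "a \<in> apex \<alpha>" for a b
  proof
    show "r b = q a" if "s b = p a"
      using z(2)[OF zt[OF \<open>b \<in> apex \<beta>\<close> \<open>a \<in> apex \<alpha>\<close> that]] by (simp add: legs_z_source)
    show "s b = p a" if "r b = q a"
      using n(2)[OF nt[OF \<open>b \<in> apex \<beta>\<close> \<open>a \<in> apex \<alpha>\<close> that]] by (simp add: legs_n_source)
  qed
  have q_surj: "\<exists>a\<in>apex \<alpha>. q a = x" if x: "x \<in> M" for x
  proof -
    obtain t where t: "t \<in> apex (z_source M \<alpha> \<beta>)" "lleg (z_source M \<alpha> \<beta>) t = x"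
      using bij_betw_ex1[OF z(1) x] by blast
    obtain b w y a where "t = ((b, w), (y, a))" by (metis surj_pair)
    then show ?thesis
      using t by (intro bexI[of _ a]) (auto simp: mem_apex_z_source legs_z_source q_def)
  qed
  have p_surj: "\<exists>a\<in>apex \<alpha>. \<exists>b\<in>apex \<beta>. p a = x \<and> s b = x" if x: "x \<in> M" for x
  proof -
    obtain t where t: "t \<in> apex (n_source M \<alpha> \<beta>)" "lleg (n_source M \<alpha> \<beta>) t = x"
      using bij_betw_ex1[OF n(1) x] by blast
    obtain b w y a where "t = ((y, b), (a, w))" by (metis surj_pair)
    then show ?thesis
      using t n(2)[OF t(1)]
      by (intro bexI[of _ a] bexI[of _ b]) (auto simp: mem_apex_n_source p_def s_def legs_n_source)
  qed
  have q_inj: "a = a'" if a: "a \<in> apex \<alpha>" "a' \<in> apex \<alpha>" and eq: "q a = q a'" for a a'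
  proof -
    obtain b where b: "b \<in> apex \<beta>" "s b = p a" using p_surj[OF pq(2)[OF a(1)]] by blast
    then have b': "s b = p a'" using composable eq a by metis
    have "((b, q a), (r b, a)) = ((b, q a'), (r b, a'))"
      by (rule inj_onD[OF bij_betw_imp_inj_on[OF z(1)] _ zt[OF b(1) a(1) b(2)] zt[OF b(1) a(2) b']])
        (simp add: legs_z_source eq)
    then show ?thesis by simp
  qed
  have p_inj: "a = a'" if a: "a \<in> apex \<alpha>" "a' \<in> apex \<alpha>" and eq: "p a = p a'" for a a'
  proof -
    obtain b where b: "b \<in> apex \<beta>" "s b = p a" using p_surj[OF pq(2)[OF a(1)]] by blast
    then have "r b = q a" "r b = q a'" using composable eq a by metis+
    then show ?thesis using q_inj[OF a] by simp
  qed
  show "bij_betw (\<lambda>a. fst (lleg \<alpha> a)) (apex \<alpha>) M"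
    unfolding p_def[symmetric] bij_betw_def inj_on_def using p_inj p_surj pq(2) by blast
  show "bij_betw (\<lambda>a. snd (lleg \<alpha> a)) (apex \<alpha>) M"
    unfolding q_def[symmetric] bij_betw_def inj_on_def using q_inj q_surj pq(3) by blast
qed

text \<open>The pairing is the graph of a bijection of \<open>M\<close>, and the copairing is the same graph with the legs
  swapped. Its apex is a copy of \<open>M\<close>, which is where the embedding into the type of apexes enters.
  The two sides of a coherence condition project its source to two copies of \<open>\<alpha>\<close> (of \<open>\<beta>\<close>, in the second
  condition). The matching conditions in the source force the two components to agree, so both
  conditions hold whatever \<open>z\<close> and \<open>n\<close> are.\<close>

lemma legs_bij_imp_biexact_witness:
  fixes \<alpha> :: "('m \<times> 'm, unit, 'a) span" and emb :: "'m \<Rightarrow> 'e"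
  assumes p: "bij_betw (\<lambda>a. fst (lleg \<alpha> a)) (apex \<alpha>) M" and q: "bij_betw (\<lambda>a. snd (lleg \<alpha> a)) (apex \<alpha>) M"
    and emb: "inj emb"
  shows "\<exists>(\<beta> :: (unit, 'm \<times> 'm, 'e) span) z n. biexact_witness M \<alpha> \<beta> z n"
proof -
  let ?p = "\<lambda>a. fst (lleg \<alpha> a)" and ?q = "\<lambda>a. snd (lleg \<alpha> a)"
  define g where "g = inv_into (apex \<alpha>) ?p"
  have g: "x \<in> M \<Longrightarrow> g x \<in> apex \<alpha>" "x \<in> M \<Longrightarrow> ?p (g x) = x" "a \<in> apex \<alpha> \<Longrightarrow> g (?p a) = a" for x a
    unfolding g_def using bij_betwE[OF bij_betw_inv_into[OF p]] bij_betw_inv_into_right[OF p]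
      bij_betw_inv_into_left[OF p] by blast+
  have pq_in: "?p a \<in> M" "?q a \<in> M" if "a \<in> apex \<alpha>" for a
    using bij_betwE[OF p] bij_betwE[OF q] that by auto
  have p_inj: "a = a'" if "?p a = ?p a'" "a \<in> apex \<alpha>" "a' \<in> apex \<alpha>" for a a'
    using that p by (auto simp: bij_betw_def dest: inj_onD)
  have q_inj: "a = a'" if "?q a = ?q a'" "a \<in> apex \<alpha>" "a' \<in> apex \<alpha>" for a a'
    using that q by (auto simp: bij_betw_def dest: inj_onD)
  \<comment> \<open>The point of \<open>\<beta>\<close> over \<open>x\<close> is the point \<open>g x\<close> of \<open>\<alpha>\<close> with first leg \<open>x\<close>, with its legs swapped.\<close>
  define \<beta> :: "(unit, 'm \<times> 'm, 'e) span" where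
    "\<beta> = \<lparr>apex = emb ` M, lleg = (\<lambda>_. ()), rleg = (\<lambda>b. (?q (g (inv emb b)), inv emb b))\<rparr>"
  have apex: "b \<in> apex \<beta> \<longleftrightarrow> (\<exists>x\<in>M. b = emb x)" for b by (auto simp: \<beta>_def)
  have rleg: "rleg \<beta> (emb x) = (?q (g x), x)" for x using emb by (simp add: \<beta>_def)
  have span: "is_span {()} (M \<times> M) \<beta>"
    using g(1) pq_in by (auto simp: is_span_def apex rleg)
  have z_apex: "t \<in> apex (z_source M \<alpha> \<beta>) \<longleftrightarrow>
      (\<exists>a\<in>apex \<alpha>. t = ((emb (?p a), ?q a), (?q a, a)))" (is "_ \<longleftrightarrow> ?R t") for t
  proof
    assume t: "t \<in> apex (z_source M \<alpha> \<beta>)"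
    obtain b w x a where t_eq: "t = ((b, w), (x, a))" by (metis surj_pair)
    obtain u where u: "b = emb u" "u \<in> M" "a \<in> apex \<alpha>" "x = ?q (g u)" "lleg \<alpha> a = (u, w)"
      using t unfolding t_eq by (auto simp: mem_apex_z_source apex rleg)
    then have "g u = a" using g(3)[of a] by simp
    then show "?R t" using u unfolding t_eq by auto
  next
    assume "?R t"
    then obtain a where a: "a \<in> apex \<alpha>" "t = ((emb (?p a), ?q a), (?q a, a))" by blast
    show "t \<in> apex (z_source M \<alpha> \<beta>)"
      unfolding a(2) mem_apex_z_source using a(1) g(3) pq_in by (auto simp: apex rleg prod_eq_iff)
  qed
  have n_apex: "t \<in> apex (n_source M \<alpha> \<beta>) \<longleftrightarrow>
      (\<exists>a\<in>apex \<alpha>. t = ((?p a, emb (?p a)), (a, ?p a)))" (is "_ \<longleftrightarrow> ?R t") for t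
  proof
    assume t: "t \<in> apex (n_source M \<alpha> \<beta>)"
    obtain b w x a where t_eq: "t = ((x, b), (a, w))" by (metis surj_pair)
    have ya: "w \<in> M" "a \<in> apex \<alpha>" "b = emb w" "lleg \<alpha> a = (x, ?q (g w))"
      using t unfolding t_eq by (auto simp: mem_apex_n_source apex rleg)
    then have "a = g w" by (intro q_inj) (simp_all add: g)
    moreover have "x = w" using ya(4) g(2)[OF ya(1)] \<open>a = g w\<close> by (metis fst_conv)
    ultimately show "?R t" using ya g(2)[of w] unfolding t_eq by auto
  next
    assume "?R t"
    then obtain a where a: "a \<in> apex \<alpha>" "t = ((?p a, emb (?p a)), (a, ?p a))" by blast
    show "t \<in> apex (n_source M \<alpha> \<beta>)"
      unfolding a(2) mem_apex_n_source using a(1) g(3) pq_in by (auto simp: apex rleg prod_eq_iff)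
  qed
  have z_bij: "bij_betw (lleg (z_source M \<alpha> \<beta>)) (apex (z_source M \<alpha> \<beta>)) M"
  proof (rule bij_betw_imageI)
    show "inj_on (lleg (z_source M \<alpha> \<beta>)) (apex (z_source M \<alpha> \<beta>))"
      by (intro inj_onI) (auto simp: z_apex legs_z_source dest!: q_inj)
    have "apex (z_source M \<alpha> \<beta>) = (\<lambda>a. ((emb (?p a), ?q a), (?q a, a))) ` apex \<alpha>"
      by (auto simp: z_apex)
    then have "lleg (z_source M \<alpha> \<beta>) ` apex (z_source M \<alpha> \<beta>) = ?q ` apex \<alpha>"
      by (simp only: image_image legs_z_source)
    then show "lleg (z_source M \<alpha> \<beta>) ` apex (z_source M \<alpha> \<beta>) = M"
      by (simp only: bij_betw_imp_surj_on[OF q])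
  qed
  have n_bij: "bij_betw (lleg (n_source M \<alpha> \<beta>)) (apex (n_source M \<alpha> \<beta>)) M"
  proof (rule bij_betw_imageI)
    show "inj_on (lleg (n_source M \<alpha> \<beta>)) (apex (n_source M \<alpha> \<beta>))"
      by (intro inj_onI) (auto simp: n_apex legs_n_source dest!: p_inj)
    have "apex (n_source M \<alpha> \<beta>) = (\<lambda>a. ((?p a, emb (?p a)), (a, ?p a))) ` apex \<alpha>"
      by (auto simp: n_apex)
    then have "lleg (n_source M \<alpha> \<beta>) ` apex (n_source M \<alpha> \<beta>) = ?p ` apex \<alpha>"
      by (simp only: image_image legs_n_source)
    then show "lleg (n_source M \<alpha> \<beta>) ` apex (n_source M \<alpha> \<beta>) = M"
      by (simp only: bij_betw_imp_surj_on[OF p])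
  qed
  have z: "invertible_2mor (z_source M \<alpha> \<beta>) (id_span M) (lleg (z_source M \<alpha> \<beta>))"
    by (rule invertible_2mor_id_spanI[OF z_bij]) (auto simp: z_apex legs_z_source)
  have n: "invertible_2mor (n_source M \<alpha> \<beta>) (id_span M) (lleg (n_source M \<alpha> \<beta>))"
    by (rule invertible_2mor_id_spanI[OF n_bij]) (auto simp: n_apex legs_n_source)
  \<comment> \<open>Both sides are \<open>\<alpha>\<close>-components of \<open>s\<close>: the outer one \<open>a'\<close> and the inner one \<open>a\<close>. Each is linked to the
      same point of \<open>\<beta>\<close>, through its first and second leg respectively, hence they are equal.\<close>
  have ax1: "axiom1_apply_n n s = axiom1_apply_z z (axiom1_interchange \<alpha> s)"
    if s: "s \<in> apex (axiom1_source M \<alpha> \<beta>)" for s n z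
  proof -
    obtain t u a' where "s = ((t, u), a')" by (metis surj_pair)
    moreover obtain x b w where "t = ((x, b), w)" by (metis surj_pair)
    moreover obtain a y w' where "u = (a, (y, w'))" by (metis surj_pair)
    ultimately have s_eq: "s = ((((x, b), w), (a, (y, w'))), a')" by simp
    have *: "a \<in> apex \<alpha>" "a' \<in> apex \<alpha>" "b \<in> apex \<beta>"
      "lleg \<alpha> a = (x, fst (rleg \<beta> b))" "lleg \<alpha> a' = (snd (rleg \<beta> b), w)"
      using s unfolding s_eq
      by (auto simp: axiom1_source_def middle_beta_def refoot_def span_comp_def span_prod_def id_span_def
          split: prod.splits)
    obtain u where u: "u \<in> M" "b = emb u" using *(3) by (auto simp: apex)
    have "a = g u" using * u by (intro q_inj) (simp_all add: rleg g)
    moreover have "a' = g u" using * u by (intro p_inj) (simp_all add: rleg g)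
    ultimately show ?thesis
      by (simp add: s_eq axiom1_apply_n_def axiom1_apply_z_def axiom1_interchange_def interchanger_def
          split: prod.splits)
  qed
  \<comment> \<open>Here the two sides are the two \<open>\<beta>\<close>-components of \<open>s\<close>, both linked to the same point of \<open>\<alpha>\<close>.\<close>
  have ax2: "axiom2_apply_n n s = axiom2_apply_z z (axiom2_interchange \<beta> s)"
    if s: "s \<in> apex (axiom2_source M \<alpha> \<beta>)" for s n z
  proof -
    obtain b t u where "s = ((b, t), u)" by (metis surj_pair)
    moreover obtain x y b' where "t = ((x, y), b')" by (metis surj_pair)
    moreover obtain x' a w where "u = ((x', a), w)" by (metis surj_pair)
    ultimately have s_eq: "s = ((b, ((x, y), b')), ((x', a), w))" by simp
    have *: "a \<in> apex \<alpha>" "b \<in> apex \<beta>" "b' \<in> apex \<beta>" "lleg \<alpha> a = (snd (rleg \<beta> b), fst (rleg \<beta> b'))"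
      using s unfolding s_eq
      by (auto simp: axiom2_source_def middle_alpha_def refoot_def span_comp_def span_prod_def id_span_def
          split: prod.splits)
    obtain u u' where u: "u \<in> M" "b = emb u" "u' \<in> M" "b' = emb u'" using *(2,3) by (auto simp: apex)
    have "a = g u" using * u by (intro p_inj) (simp_all add: rleg g)
    moreover have "a = g u'" using * u by (intro q_inj) (simp_all add: rleg g)
    ultimately have "u = u'" using g(2) u by metis
    then show ?thesis using u
      by (simp add: s_eq axiom2_apply_n_def axiom2_apply_z_def axiom2_interchange_def interchanger_def
          split: prod.splits)
  qed
  have "biexact_witness M \<alpha> \<beta> (lleg (z_source M \<alpha> \<beta>)) (lleg (n_source M \<alpha> \<beta>))"
    unfolding biexact_witness_def using span z n ax1 ax2 by blast
  then show ?thesis by blast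
qed

section \<open>Counits and Frobenius sets\<close>

lemma invertible_2mor_refl: "invertible_2mor f f id"
  by (auto simp: invertible_2mor_def span_2mor_def)

lemma invertible_2mor_sym:
  assumes "invertible_2mor f g h"
  shows "\<exists>k. invertible_2mor g f k"
  using assms unfolding invertible_2mor_def by blast

lemma invertible_2mor_trans:
  assumes "invertible_2mor f g h" "invertible_2mor g f' h'"
  shows "invertible_2mor f f' (h' \<circ> h)"
proof -
  obtain k where k: "span_2mor g f k" "\<forall>a\<in>apex f. k (h a) = a" "\<forall>b\<in>apex g. h (k b) = b"
    and h: "span_2mor f g h" using assms(1) by (auto simp: invertible_2mor_def)
  obtain k' where k': "span_2mor f' g k'" "\<forall>a\<in>apex g. k' (h' a) = a" "\<forall>b\<in>apex f'. h' (k' b) = b"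
    and h': "span_2mor g f' h'" using assms(2) by (auto simp: invertible_2mor_def)
  have "span_2mor f f' (h' \<circ> h)" "span_2mor f' f (k \<circ> k')"
    using h h' k(1) k'(1) by (auto simp: span_2mor_def Pi_iff)
  moreover have "\<forall>a\<in>apex f. (k \<circ> k') ((h' \<circ> h) a) = a" "\<forall>b\<in>apex f'. (h' \<circ> h) ((k \<circ> k') b) = b"
    using h h' k k' by (auto simp: span_2mor_def Pi_iff)
  ultimately show ?thesis unfolding invertible_2mor_def by blast
qed

lemma equiv_frobenius_equiv: "equiv {\<epsilon>. frobenius_structure A \<epsilon>} (frobenius_equiv A)"
proof (rule equivI)
  show "frobenius_equiv A \<subseteq> {\<epsilon>. frobenius_structure A \<epsilon>} \<times> {\<epsilon>. frobenius_structure A \<epsilon>}"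
    by (auto simp: frobenius_equiv_def)
  show "refl_on {\<epsilon>. frobenius_structure A \<epsilon>} (frobenius_equiv A)"
    using invertible_2mor_refl by (fastforce simp: refl_on_def frobenius_equiv_def)
  show "sym (frobenius_equiv A)"
    using invertible_2mor_sym by (fastforce simp: sym_def frobenius_equiv_def)
  show "trans (frobenius_equiv A)"
    using invertible_2mor_trans by (fastforce simp: trans_def frobenius_equiv_def)
qed

lemma invertible_2mor_image_lleg:
  assumes "invertible_2mor f g h"
  shows "lleg f ` apex f = lleg g ` apex g"
proof -
  obtain k where h: "span_2mor f g h" and k: "span_2mor g f k"
    using assms by (auto simp: invertible_2mor_def)
  have "lleg f a \<in> lleg g ` apex g" if "a \<in> apex f" for a
    using h that by (intro image_eqI[of _ _ "h a"]) (auto simp: span_2mor_def)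
  moreover have "lleg g b \<in> lleg f ` apex f" if "b \<in> apex g" for b
    using k that by (intro image_eqI[of _ _ "k b"]) (auto simp: span_2mor_def)
  ultimately show ?thesis by blast
qed

text \<open>The standard counit with image \<open>E\<close>: the inclusion of \<open>E\<close>, up to the renaming of its points by
  \<open>emb\<close>.\<close>

definition counit_span :: "('a \<Rightarrow> 'e) \<Rightarrow> 'a set \<Rightarrow> ('a, unit, 'e) span" where
  "counit_span emb E = \<lparr>apex = emb ` E, lleg = inv emb, rleg = (\<lambda>_. ())\<rparr>"

lemma image_lleg_counit_span: "inj emb \<Longrightarrow> lleg (counit_span emb E) ` apex (counit_span emb E) = E"
  by (simp add: counit_span_def image_image)

text \<open>Reduces every counit with injective leg to a standard representative of its class; the leg is a
  bijection onto its image, and the copy of the image is the new apex.\<close>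

lemma invertible_2mor_counit_span:
  fixes \<epsilon> :: "('a, unit, 'e) span"
  assumes emb: "inj emb" and inj: "inj_on (lleg \<epsilon>) (apex \<epsilon>)"
  shows "invertible_2mor \<epsilon> (counit_span emb (lleg \<epsilon> ` apex \<epsilon>)) (\<lambda>a. emb (lleg \<epsilon> a))"
  unfolding invertible_2mor_def
proof (intro conjI exI[of _ "\<lambda>b. inv_into (apex \<epsilon>) (lleg \<epsilon>) (inv emb b)"] ballI)
  show "span_2mor \<epsilon> (counit_span emb (lleg \<epsilon> ` apex \<epsilon>)) (\<lambda>a. emb (lleg \<epsilon> a))"
    using emb by (auto simp: span_2mor_def counit_span_def)
  show "span_2mor (counit_span emb (lleg \<epsilon> ` apex \<epsilon>)) \<epsilon> (\<lambda>b. inv_into (apex \<epsilon>) (lleg \<epsilon>) (inv emb b))"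
    using emb inj by (auto simp: span_2mor_def counit_span_def inv_into_into f_inv_into_f)
qed (use emb inj in \<open>auto simp: counit_span_def\<close>)

lemma segal_pseudomonoid_simps:
  "carrier (segal_pseudomonoid X) = ob X 1"
  "mult (segal_pseudomonoid X) =
     \<lparr>apex = ob X 2, lleg = (\<lambda>\<psi>. (face X 2 2 \<psi>, face X 2 0 \<psi>)), rleg = face X 2 1\<rparr>"
  by (simp_all add: segal_pseudomonoid_def Let_def)

lemma long_edge_2: "long_edge X 2 \<xi> = face X 2 1 \<xi>"
  unfolding face_eq_restrict_along by (simp, rule restrict_along_cong) (auto dest!: le_1_cases)

text \<open>If two points \<open>a\<close> and \<open>a'\<close> of the counit had the same image \<open>y\<close>, then the triangle \<open>s\<^sub>0 y\<close>, whose long edge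
  is \<open>y\<close>, would give two points of the pairing with the same legs. Once the leg of \<open>\<epsilon>\<close> is injective, the
  apex of the pairing is the set of closings of edges, with \<open>d\<^sub>2\<close> and \<open>d\<^sub>0\<close> as legs.\<close>

lemma pairing_legs_bij_iff:
  fixes \<epsilon> :: "('a, unit, 'e) span" and X :: "'a presheaf_data"
  defines "\<alpha> \<equiv> \<epsilon> \<odot> mult (segal_pseudomonoid X)"
  assumes S: "simplicial_set X" and \<epsilon>: "lleg \<epsilon> \<in> apex \<epsilon> \<rightarrow> ob X 1"
  shows "bij_betw (\<lambda>a. fst (lleg \<alpha> a)) (apex \<alpha>) (ob X 1) \<and> bij_betw (\<lambda>a. snd (lleg \<alpha> a)) (apex \<alpha>) (ob X 1)
    \<longleftrightarrow> inj_on (lleg \<epsilon>) (apex \<epsilon>) \<and> frobenius_set X (lleg \<epsilon> ` apex \<epsilon>)"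
    (is "?B \<longleftrightarrow> _ \<and> frobenius_set X ?E")
proof -
  have apex: "apex \<alpha> = {(\<xi>, a). \<xi> \<in> ob X 2 \<and> a \<in> apex \<epsilon> \<and> face X 2 1 \<xi> = lleg \<epsilon> a}"
    and lleg: "lleg \<alpha> t = (face X 2 2 (fst t), face X 2 0 (fst t))" for t
    by (simp_all add: \<alpha>_def span_comp_def segal_pseudomonoid_simps)
  have cl: "closings X ?E 1 = {\<xi> \<in> ob X 2. face X 2 1 \<xi> \<in> ?E}"
    using long_edge_2[of X] by (simp add: closings_def numeral_2_eq_2)
  then have fst_image: "fst ` apex \<alpha> = closings X ?E 1" by (force simp: apex)
  have inj: "inj_on (lleg \<epsilon>) (apex \<epsilon>)" if ?B
  proof (rule inj_onI)
    fix a a' assume a: "a \<in> apex \<epsilon>" "a' \<in> apex \<epsilon>" "lleg \<epsilon> a = lleg \<epsilon> a'"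
    let ?y = "lleg \<epsilon> a"
    have y: "?y \<in> ob X 1" using \<epsilon> a by blast
    have "degen X 1 0 ?y \<in> ob X 2"
      using y by (simp add: degen_eq_restrict_along numeral_2_eq_2[symmetric])
        (rule restrict_along_in[OF S]; auto simp: vertex_map_def)
    moreover have "face X 2 1 (degen X 1 0 ?y) = ?y"
      by (simp add: face_eq_restrict_along degen_eq_restrict_along numeral_2_eq_2[symmetric])
        (rule restrict_along_section[OF S y[simplified]]; auto simp: vertex_map_def)
    ultimately have "(degen X 1 0 ?y, a) \<in> apex \<alpha>" "(degen X 1 0 ?y, a') \<in> apex \<alpha>"
      using a by (auto simp: apex)
    moreover have "inj_on (\<lambda>a. fst (lleg \<alpha> a)) (apex \<alpha>)" using that by (simp add: bij_betw_def)
    ultimately have "(degen X 1 0 ?y, a) = (degen X 1 0 ?y, a')"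
      by (elim inj_onD) (simp_all add: lleg)
    then show "a = a'" by simp
  qed
  have "?B \<longleftrightarrow> frobenius_set X ?E" if "inj_on (lleg \<epsilon>) (apex \<epsilon>)"
  proof -
    have "inj_on fst (apex \<alpha>)" using that by (auto simp: apex inj_on_def)
    then have fst: "bij_betw fst (apex \<alpha>) (closings X ?E 1)" using fst_image by (simp add: bij_betw_def)
    have E1: "?E \<subseteq> ob X 1" using \<epsilon> by blast
    show ?thesis
      unfolding lleg fst_conv snd_conv frobenius_set_def
      using bij_betw_comp_iff[OF fst, of "face X 2 2" "ob X 1"] bij_betw_comp_iff[OF fst, of "face X 2 0" "ob X 1"] E1
      by (simp add: comp_def)
  qed
  then show ?thesis using inj by blast
qed

lemma frobenius_structure_iff:
  fixes \<epsilon> :: "('a, unit, 'e) span" and X :: "'a presheaf_data" and emb :: "'a \<Rightarrow> 'e"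
  assumes S: "simplicial_set X" and emb: "inj emb" and \<epsilon>: "lleg \<epsilon> \<in> apex \<epsilon> \<rightarrow> ob X 1"
  shows "frobenius_structure (segal_pseudomonoid X) \<epsilon> \<longleftrightarrow>
    inj_on (lleg \<epsilon>) (apex \<epsilon>) \<and> frobenius_set X (lleg \<epsilon> ` apex \<epsilon>)"
proof -
  let ?\<alpha> = "\<epsilon> \<odot> mult (segal_pseudomonoid X)"
  have \<alpha>: "lleg ?\<alpha> \<in> apex ?\<alpha> \<rightarrow> ob X 1 \<times> ob X 1"
    using end_faces_in[OF S, of _ 1] by (auto simp: span_comp_def segal_pseudomonoid_simps numeral_2_eq_2)
  have "is_span (ob X 1) {()} \<epsilon>" using \<epsilon> by (simp add: is_span_def)
  then have "frobenius_structure (segal_pseudomonoid X) \<epsilon> \<longleftrightarrow>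
      (\<exists>(\<beta> :: (unit, 'a \<times> 'a, 'e) span) z n. biexact_witness (ob X 1) ?\<alpha> \<beta> z n)"
    unfolding frobenius_structure_def segal_pseudomonoid_simps(1) by (simp only: simp_thms)
  also have "\<dots> \<longleftrightarrow> bij_betw (\<lambda>a. fst (lleg ?\<alpha> a)) (apex ?\<alpha>) (ob X 1) \<and>
      bij_betw (\<lambda>a. snd (lleg ?\<alpha> a)) (apex ?\<alpha>) (ob X 1)" (is "?L \<longleftrightarrow> ?R")
  proof
    assume ?L
    then obtain \<beta> :: "(unit, 'a \<times> 'a, 'e) span" and z n
      where wit: "biexact_witness (ob X 1) ?\<alpha> \<beta> z n" by (elim exE)
    show ?R by (intro conjI biexact_witness_imp_legs_bij[OF wit \<alpha>])
  next
    assume ?R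
    then show ?L by (elim conjE) (rule legs_bij_imp_biexact_witness[OF _ _ emb])
  qed
  also have "\<dots> \<longleftrightarrow> inj_on (lleg \<epsilon>) (apex \<epsilon>) \<and> frobenius_set X (lleg \<epsilon> ` apex \<epsilon>)"
    by (rule pairing_legs_bij_iff[OF S \<epsilon>])
  finally show ?thesis .
qed

theorem theorem4p2:
  fixes X :: "'a presheaf_data"
    and emb :: "'a \<Rightarrow> 'e"
  assumes "two_segal X"
    and "inj emb"
  shows "\<exists>\<Phi>. bij_betw \<Phi> {P. paracyclic_structure X P}
           (frobenius_classes (segal_pseudomonoid X) :: ('a, unit, 'e) span set set)"
proof -
  note X = assms(1) and emb = assms(2)
  have S: "simplicial_set X" using X by (simp add: two_segal_def)
  let ?A = "segal_pseudomonoid X"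
  let ?R = "frobenius_equiv ?A :: (('a, unit, 'e) span \<times> ('a, unit, 'e) span) set"
  let ?cls = "\<lambda>E. ?R `` {counit_span emb E}"
  have counit: "frobenius_structure ?A (counit_span emb E)" if E: "frobenius_set X E" for E
  proof -
    have "E \<subseteq> ob X 1" using E by (simp add: frobenius_set_def)
    then have "lleg (counit_span emb E) \<in> apex (counit_span emb E) \<rightarrow> ob X 1"
      using emb by (auto simp: counit_span_def)
    moreover have "inj_on (lleg (counit_span emb E)) (apex (counit_span emb E))"
      using emb by (auto simp: counit_span_def inj_on_def)
    ultimately show ?thesis
      using frobenius_structure_iff[OF S emb] E image_lleg_counit_span[OF emb] by simp
  qed
  have classes: "bij_betw ?cls {E. frobenius_set X E} (frobenius_classes ?A)"
  proof (rule bij_betw_imageI)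
    show "inj_on ?cls {E. frobenius_set X E}"
    proof (rule inj_onI)
      fix E E' assume "E \<in> {E. frobenius_set X E}" "E' \<in> {E. frobenius_set X E}" "?cls E = ?cls E'"
      then have "(counit_span emb E, counit_span emb E') \<in> ?R"
        using eq_equiv_class[OF _ equiv_frobenius_equiv] counit by blast
      then obtain h where "invertible_2mor (counit_span emb E) (counit_span emb E') h"
        by (auto simp: frobenius_equiv_def)
      from invertible_2mor_image_lleg[OF this] show "E = E'"
        unfolding image_lleg_counit_span[OF emb] .
    qed
    have "?cls E \<in> frobenius_classes ?A" if "frobenius_set X E" for E
      using counit[OF that] by (auto simp: frobenius_classes_def intro: quotientI)
    moreover have "Q \<in> ?cls ` {E. frobenius_set X E}" if Q: "Q \<in> frobenius_classes ?A" for Q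
    proof -
      obtain \<epsilon> where \<epsilon>: "frobenius_structure ?A \<epsilon>" "Q = ?R `` {\<epsilon>}"
        using Q by (auto simp: frobenius_classes_def elim: quotientE)
      have "lleg \<epsilon> \<in> apex \<epsilon> \<rightarrow> ob X 1"
        using \<epsilon>(1) by (simp add: frobenius_structure_def is_span_def segal_pseudomonoid_simps)
      then have inj: "inj_on (lleg \<epsilon>) (apex \<epsilon>)" and E: "frobenius_set X (lleg \<epsilon> ` apex \<epsilon>)"
        using \<epsilon>(1) frobenius_structure_iff[OF S emb] by blast+
      have "(\<epsilon>, counit_span emb (lleg \<epsilon> ` apex \<epsilon>)) \<in> ?R"
        using \<epsilon>(1) counit[OF E] invertible_2mor_counit_span[OF emb inj] by (auto simp: frobenius_equiv_def)
      then have "Q = ?cls (lleg \<epsilon> ` apex \<epsilon>)"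
        unfolding \<epsilon>(2) by (rule equiv_class_eq[OF equiv_frobenius_equiv])
      then show ?thesis using E by blast
    qed
    ultimately show "?cls ` {E. frobenius_set X E} = frobenius_classes ?A" by blast
  qed
  have "bij_betw frobenius_set_of {P. paracyclic_structure X P} {E. frobenius_set X E}"
    by (rule bij_betw_byWitness[where f' = "paracyclic_extension X"])
      (auto simp: paracyclic_extension_frobenius_set_of[OF X] frobenius_set_of_extension[OF X]
        frobenius_set_frobenius_set_of[OF X] paracyclic_structure_extension[OF X])
  from bij_betw_trans[OF this classes] show ?thesis by blast
qed

end
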